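(* Let $\mathfrak M$ be the variety of associative algebras defined by the identity $[x^2,y]=0$, and let $f\in F(\mathfrak M)$. Then the consequences of higher degree of $f$ in $F(\mathfrak M)$ are as follows. (a) If $f=x^n$, $n\geq 1$, they are equivalent to the identity $x_1x_2\cdots x_{n+1}$. (b) If $f=[x_1,x_2]x_1$ or $f=S_3(x_1,x_2,x_3)$, they are equivalent to the identity $x_1[x_1,x_2]x_2$. (c) $f=x_1[x_1,x_2]x_2$ does not have (nonzero) consequences of higher degree.
   Context: $K$ is a field of characteristic $0$; algebras are associative $K$-algebras, not necessarily unital. $A=K\langle x_1,x_2,\ldots\rangle$ is the free non-unitary associative algebra (the letters $x,y,z,\ldots$ also denote distinct free generators). For a variety $\mathfrak M$, $T(\mathfrak M)\subset A$ is the T-ideal of its polynomial identities and $F(\mathfrak M)=A/T(\mathfrak M)$ is the relatively free algebra. $[x,y]=xy-yx$ and $S_n(x_1,\ldots,x_n)=\sum_{\sigma\in S_n}(-1)^\sigma x_{\sigma(1)}\cdots x_{\sigma(n)}$. For $f$ homogeneous of degree $n$, its consequences of higher degree in $F(\mathfrak M)$ are the elements of the T-ideal of $F(\mathfrak M)$ generated by $f$ all of whose homogeneous components have degree $>n$. They are "equivalent to the identities $g_1,\ldots,g_s$" if the set of all of them coincides with the T-ideal of $F(\mathfrak M)$ generated by $g_1,\ldots,g_s$; $f$ "does not have consequences of higher degree" if this set is $\{0\}$. *)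

theory Defs
  imports
    Complex_Main
    "HOL-Library.Poly_Mapping"
    "HOL-Combinatorics.Permutations"
begin

section \<open>Associative algebras, not necessarily unital, with explicit carriers\<close>

record ('k, 'b) alg =
  carr :: "'b set"
  add :: "'b \<Rightarrow> 'b \<Rightarrow> 'b"
  zer :: "'b"
  mul :: "'b \<Rightarrow> 'b \<Rightarrow> 'b"
  scal :: "'k \<Rightarrow> 'b \<Rightarrow> 'b"

text \<open>Additive inverses are given by scalar multiplication with \<open>-1\<close>.\<close>

locale assoc_algebra =
  fixes B :: "('k::field, 'b) alg"
  assumes add_closed: "\<lbrakk>a \<in> carr B; b \<in> carr B\<rbrakk> \<Longrightarrow> add B a b \<in> carr B"
    and zer_closed: "zer B \<in> carr B"
    and mul_closed: "\<lbrakk>a \<in> carr B; b \<in> carr B\<rbrakk> \<Longrightarrow> mul B a b \<in> carr B"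
    and scal_closed: "a \<in> carr B \<Longrightarrow> scal B c a \<in> carr B"
    and add_assoc: "\<lbrakk>a \<in> carr B; b \<in> carr B; d \<in> carr B\<rbrakk> \<Longrightarrow>
      add B (add B a b) d = add B a (add B b d)"
    and add_commute: "\<lbrakk>a \<in> carr B; b \<in> carr B\<rbrakk> \<Longrightarrow> add B a b = add B b a"
    and zer_add: "a \<in> carr B \<Longrightarrow> add B (zer B) a = a"
    and zero_scal: "a \<in> carr B \<Longrightarrow> scal B 0 a = zer B"
    and one_scal: "a \<in> carr B \<Longrightarrow> scal B 1 a = a"
    and scal_scal: "a \<in> carr B \<Longrightarrow> scal B c (scal B e a) = scal B (c * e) a"
    and scal_add: "\<lbrakk>a \<in> carr B; b \<in> carr B\<rbrakk> \<Longrightarrow>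
      scal B c (add B a b) = add B (scal B c a) (scal B c b)"
    and add_scal: "a \<in> carr B \<Longrightarrow>
      scal B (c + e) a = add B (scal B c a) (scal B e a)"
    and mul_assoc: "\<lbrakk>a \<in> carr B; b \<in> carr B; d \<in> carr B\<rbrakk> \<Longrightarrow>
      mul B (mul B a b) d = mul B a (mul B b d)"
    and add_mul: "\<lbrakk>a \<in> carr B; b \<in> carr B; d \<in> carr B\<rbrakk> \<Longrightarrow>
      mul B (add B a b) d = add B (mul B a d) (mul B b d)"
    and mul_add: "\<lbrakk>a \<in> carr B; b \<in> carr B; d \<in> carr B\<rbrakk> \<Longrightarrow>
      mul B a (add B b d) = add B (mul B a b) (mul B a d)"
    and scal_mul: "\<lbrakk>a \<in> carr B; b \<in> carr B\<rbrakk> \<Longrightarrow>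
      mul B (scal B c a) b = scal B c (mul B a b)"
    and mul_scal: "\<lbrakk>a \<in> carr B; b \<in> carr B\<rbrakk> \<Longrightarrow>
      mul B a (scal B c b) = scal B c (mul B a b)"

definition alg_hom :: "('k, 'a) alg \<Rightarrow> ('k, 'b) alg \<Rightarrow> ('a \<Rightarrow> 'b) set" where
  "alg_hom B C = {\<phi>. \<phi> ` carr B \<subseteq> carr C
     \<and> (\<forall>a\<in>carr B. \<forall>b\<in>carr B. \<phi> (add B a b) = add C (\<phi> a) (\<phi> b))
     \<and> (\<forall>a\<in>carr B. \<forall>b\<in>carr B. \<phi> (mul B a b) = mul C (\<phi> a) (\<phi> b))
     \<and> (\<forall>c. \<forall>a\<in>carr B. \<phi> (scal B c a) = scal C c (\<phi> a))}"

definition t_ideal :: "('k, 'b) alg \<Rightarrow> 'b set \<Rightarrow> bool" where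
  "t_ideal B J \<longleftrightarrow> J \<subseteq> carr B \<and> zer B \<in> J
     \<and> (\<forall>a\<in>J. \<forall>b\<in>J. add B a b \<in> J)
     \<and> (\<forall>c. \<forall>a\<in>J. scal B c a \<in> J)
     \<and> (\<forall>a\<in>J. \<forall>b\<in>carr B. mul B a b \<in> J \<and> mul B b a \<in> J)
     \<and> (\<forall>\<phi>\<in>alg_hom B B. \<phi> ` J \<subseteq> J)"

definition t_ideal_gen :: "('k, 'b) alg \<Rightarrow> 'b set \<Rightarrow> 'b set" where
  "t_ideal_gen B S = \<Inter>{J. t_ideal B J \<and> S \<subseteq> J}"

definition coset :: "('k, 'b) alg \<Rightarrow> 'b set \<Rightarrow> 'b \<Rightarrow> 'b set" where
  "coset B J a = {add B a j |j. j \<in> J}"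

definition quot_alg :: "('k, 'b) alg \<Rightarrow> 'b set \<Rightarrow> ('k, 'b set) alg" where
  "quot_alg B J = \<lparr>carr = coset B J ` carr B,
     add = (\<lambda>U V. \<Union>a\<in>U. \<Union>b\<in>V. coset B J (add B a b)),
     zer = coset B J (zer B),
     mul = (\<lambda>U V. \<Union>a\<in>U. \<Union>b\<in>V. coset B J (mul B a b)),
     scal = (\<lambda>c U. \<Union>a\<in>U. coset B J (scal B c a))\<rparr>"

section \<open>The free algebra\<close>

text \<open>Words over the alphabet \<open>nat\<close> form the free monoid, written additively as required by
  the convolution product of \<^theory>\<open>HOL-Library.Poly_Mapping\<close>.  The type \<open>nc_poly\<close> is thus the
  unital free algebra; the non-unitary one consists of the elements without constant term.\<close>

instantiation list :: (type) monoid_add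
begin

definition zero_list :: "'a list" where "0 = []"

definition plus_list :: "'a list \<Rightarrow> 'a list \<Rightarrow> 'a list" where "xs + ys = xs @ ys"

instance by standard (simp_all add: zero_list_def plus_list_def)

end

type_synonym 'k nc_poly = "nat list \<Rightarrow>\<^sub>0 'k"

definition free_alg :: "('k::field, 'k nc_poly) alg" where
  "free_alg = \<lparr>carr = {p. Poly_Mapping.lookup p [] = 0}, add = (+), zer = 0, mul = (*),
     scal = (\<lambda>c. Poly_Mapping.map ((*) c))\<rparr>"

definition X :: "nat \<Rightarrow> 'k::field nc_poly" where
  "X i = Poly_Mapping.single [i] 1"

definition comm :: "'a::ring \<Rightarrow> 'a \<Rightarrow> 'a" where
  "comm a b = a * b - b * a"

definition standard_poly :: "nat \<Rightarrow> 'k::field nc_poly" where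
  "standard_poly n =
     (\<Sum>\<sigma> | \<sigma> permutes {1..n}. of_int (sign \<sigma>) * prod_list (map (\<lambda>i. X (\<sigma> i)) [1..<Suc n]))"

definition hom_part :: "nat \<Rightarrow> 'k::field nc_poly \<Rightarrow> 'k nc_poly" where
  "hom_part d p = (\<Sum>w | w \<in> Poly_Mapping.keys p \<and> length w = d. Poly_Mapping.single w (Poly_Mapping.lookup p w))"

section \<open>Varieties and relatively free algebras\<close>

definition satisfies :: "('k::field, 'b) alg \<Rightarrow> 'k nc_poly \<Rightarrow> bool" where
  "satisfies B g \<longleftrightarrow> (\<forall>\<phi>\<in>alg_hom free_alg B. \<phi> g = zer B)"

definition variety :: "'k::field nc_poly set \<Rightarrow> ('k, 'b) alg set" where
  "variety I = {B. assoc_algebra B \<and> (\<forall>g\<in>I. satisfies B g)}"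

definition identities_of :: "('k::field, 'b) alg set \<Rightarrow> 'k nc_poly set" where
  "identities_of M = {g \<in> carr free_alg. \<forall>B\<in>M. satisfies B g}"

definition rel_free :: "('k::field, 'b) alg set \<Rightarrow> ('k, 'k nc_poly set) alg" where
  "rel_free M = quot_alg free_alg (identities_of M)"

definition cls :: "('k::field, 'b) alg set \<Rightarrow> 'k nc_poly \<Rightarrow> 'k nc_poly set" where
  "cls M p = coset free_alg (identities_of M) p"

text \<open>The grading that the relatively free algebra inherits from the free algebra.\<close>

definition component :: "('k::field, 'b) alg set \<Rightarrow> nat \<Rightarrow> 'k nc_poly set \<Rightarrow> 'k nc_poly set" where
  "component M d U = (\<Union>p\<in>U. cls M (hom_part d p))"

definition homogeneous :: "('k::field, 'b) alg set \<Rightarrow> nat \<Rightarrow> 'k nc_poly set \<Rightarrow> bool" where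
  "homogeneous M n f \<longleftrightarrow> f \<in> carr (rel_free M) \<and> component M n f = f"

definition higher_consequences ::
    "('k::field, 'b) alg set \<Rightarrow> 'k nc_poly set \<Rightarrow> 'k nc_poly set set" where
  "higher_consequences M f = {u \<in> t_ideal_gen (rel_free M) {f}. \<exists>n. homogeneous M n f
     \<and> (\<forall>d. component M d u \<noteq> zer (rel_free M) \<longrightarrow> n < d)}"

text \<open>The variety defined by \<open>[x\<^sup>2, y] = 0\<close>.  Its members must be taken in some fixed type.
  Whether an algebra satisfies an identity depends only on its countably generated subalgebras;
  these are quotients of the free algebra and so have isomorphic copies whose elements are
  cosets.  Hence the type below is large enough for \<^const>\<open>identities_of\<close> to be the set of
  identities of the whole class of algebras.\<close>

definition sq_central :: "('k::field, 'k nc_poly set) alg set" where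
  "sq_central = variety {comm (X 1 ^ 2) (X 2)}"

end

theory Submission
  imports Defs
begin

text \<open>Write \<open>a \<circ> b = a b + b a\<close> and let \<open>T\<close> be the ideal of identities. Linearising, \<open>a \<circ> b\<close> is
  central modulo \<open>T\<close>; centrality of \<open>(a \<circ> b) \<circ> c\<close> then gives \<open>(a \<circ> b) [c, d] \<in> T\<close>. Together
  these relations make any two words of degree at least 5 with the same letters agree
  modulo \<open>T\<close>, and in degree 4 they agree modulo \<open>x [x, y] y\<close>. Hence the higher consequences of an
  element of the commutator ideal lie in the T-ideal of \<open>x [x, y] y\<close> when its degree is 3, and
  vanish when its degree is 4. For \<open>x\<^sup>n\<close> with \<open>n \<ge> 4\<close>, multiplying the multilinear
  component of \<open>(x\<^sub>1 + \<dots> + x\<^sub>n)\<^sup>n\<close> by \<open>x\<^bsub>n+1\<^esub>\<close> leads to words of degree at least 5, where the \<open>n!\<close>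
  summands coincide; \<open>n = 2, 3\<close> are computed directly. Since \<open>T\<close> is closed under rescaling the
  variables, it is homogeneous, so degrees are meaningful in the relatively free algebra.\<close>

text \<open>The statement lives in a quotient, while computations need polynomials. T-ideals of the
  relatively free algebra correspond to T-ideals of the free algebra containing \<open>T\<close>:
  endomorphisms of the quotient lift by freeness, and substitutions descend because they preserve
  \<open>T\<close>. Every claim becomes membership in a T-ideal that contains \<open>T\<close>. A
  consequence of degree above n is there a polynomial whose part of degree at most n lies in
  \<open>T\<close>; that part need not be zero.

  Degree 4 is the critical case. Modulo \<open>T\<close> the expression E(a,b,c,d) = [a,b]cd has the
  symmetries of a curvature tensor: it is skew in a, b and in c, d, symmetric under exchange of the
  two pairs, and satisfies the cyclic (Bianchi) identity. Since x[x,y]y agrees with -E(x,y,x,y), it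
  plays the role of sectional curvature, and when that vanishes so does E. In degree 5 a sign
  conflict kills every commutator: next to it, moving a factor past a product of two at one stroke,
  or past its factors one by one, gives opposite signs.\<close>

abbreviation (input) "lookup \<equiv> Poly_Mapping.lookup"
abbreviation (input) "keys \<equiv> Poly_Mapping.keys"
abbreviation (input) "single \<equiv> Poly_Mapping.single"

section \<open>The free algebra and its endomorphisms\<close>

lemma carr_free_alg: "p \<in> carr free_alg \<longleftrightarrow> lookup p [] = 0"
  by (simp add: free_alg_def)

text \<open>Scalars become constants \<open>single [] c\<close> of the unital algebra, so that the
  ring laws of \<open>nc_poly\<close> apply to them. A nonzero constant lies outside the carrier, so
  closure of an ideal under scalars stays separate from closure under multiplication.\<close>

lemma free_alg_simps [simp]:
  "add free_alg = (+)" "zer free_alg = 0" "mul free_alg = (*)"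
  "scal free_alg c p = single [] c * p"
  by (simp_all add: free_alg_def mult_map_scale_conv_mult zero_list_def fun_eq_iff)

lemma single_mult_single: "single u a * single v b = single (u @ v) (a * b)"
  by (simp add: mult_single plus_list_def)

lemma single_Nil_one [simp]: "single [] 1 = 1"
  by (simp flip: zero_list_def)

lemma lookup_const_mult [simp]: "lookup (single [] c * p) w = (c :: 'k::field) * lookup p w"
  using lookup_zero map.rep_eq[of "(*) c" p]
  by (simp add: when_def flip: mult_map_scale_conv_mult zero_list_def)

lemma update_eq_add: "a \<notin> keys p \<Longrightarrow> Poly_Mapping.update a b p = p + single a b"
  by (intro poly_mapping_eqI)
    (auto simp: lookup_update lookup_add lookup_single when_def in_keys_iff)

lemma const_mult_commute: "p * single [] (c :: 'k::field) = single [] c * p"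
proof (rule poly_mapping_eqI)
  fix w
  have "lookup (p * single [] c) w = lookup p w * c"
  proof (induction p rule: Poly_Mapping.update_induct)
    case const
    then show ?case by simp
  next
    case (update p a b)
    show ?case
      using update by (simp add: update_eq_add distrib_right lookup_add single_mult_single lookup_single when_def)
  qed
  then show "lookup (p * single [] c) w = lookup (single [] c * p) w"
    by (simp add: mult.commute)
qed

text \<open>Only words occurring in \<open>q\<close> are added, so a property of all words of
  \<open>q\<close>, such as being nonempty, is available at every step.\<close>

lemma nc_poly_induct [case_names zero add]:
  fixes p :: "'k::field nc_poly"
  assumes "P 0" and "\<And>p w c. P p \<Longrightarrow> w \<in> keys q \<Longrightarrow> P (p + single w c)"
  shows "P q"
proof -
  have "keys p \<subseteq> keys q \<longrightarrow> P p" for p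
  proof (induction p rule: Poly_Mapping.update_induct)
    case const
    then show ?case using assms(1) by simp
  next
    case (update p a b)
    have "P (p + single a b)" if "keys (Poly_Mapping.update a b p) \<subseteq> keys q"
      using that update assms(2)[of p a b] by (auto simp: keys_update)
    then show ?case
      using update by (auto simp: update_eq_add)
  qed
  then show ?thesis by blast
qed

lemma lookup_mult_Nil: "lookup (p * q) [] = lookup p [] * lookup q ([] :: nat list)"
  for p q :: "'k::field nc_poly"
proof (induction p rule: nc_poly_induct)
  case zero
  then show ?case by simp
next
  case (add p w c)
  have "lookup (single w c * q) [] = lookup (single w c) [] * lookup q []"
  proof (induction q rule: nc_poly_induct)
    case (add q v b)
    then show ?case
      by (simp add: distrib_left lookup_add single_mult_single lookup_single when_def)
  qed simp
  with add show ?case by (simp add: distrib_right lookup_add)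
qed

lemma carr_free_algI [simp, intro]:
  "0 \<in> carr free_alg" "X i \<in> carr free_alg"
  "p \<in> carr free_alg \<Longrightarrow> q \<in> carr free_alg \<Longrightarrow> p + q \<in> carr free_alg"
  "p \<in> carr free_alg \<Longrightarrow> q \<in> carr free_alg \<Longrightarrow> p - q \<in> carr free_alg"
  "p \<in> carr free_alg \<Longrightarrow> - p \<in> carr free_alg"
  "p \<in> carr free_alg \<Longrightarrow> p * q \<in> carr free_alg"
  "q \<in> carr free_alg \<Longrightarrow> p * q \<in> carr free_alg"
  "p \<in> carr free_alg \<Longrightarrow> q \<in> carr free_alg \<Longrightarrow> comm p q \<in> carr free_alg"
  "w \<noteq> [] \<Longrightarrow> single w c \<in> carr free_alg"
  by (simp_all add: carr_free_alg X_def lookup_add lookup_minus lookup_mult_Nil lookup_single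
      comm_def when_def)

lemma keys_carr: "p \<in> carr free_alg \<Longrightarrow> w \<in> keys p \<Longrightarrow> w \<noteq> []"
  by (auto simp: carr_free_alg in_keys_iff)

lemma carr_induct [consumes 1, case_names zero add]:
  assumes "q \<in> carr free_alg" "P 0"
    and "\<And>p w c. P p \<Longrightarrow> p \<in> carr free_alg \<Longrightarrow> w \<noteq> [] \<Longrightarrow> P (p + single w c)"
  shows "P (q :: 'k::field nc_poly)"
proof -
  have "P q \<and> q \<in> carr free_alg"
  proof (induction q rule: nc_poly_induct)
    case (add p w c)
    then show ?case using assms(3)[of p w c] keys_carr[OF assms(1), of w] by auto
  qed (use assms in auto)
  then show ?thesis by simp
qed

section \<open>Substitutions, the endomorphisms of the free algebra\<close>

definition subst :: "(nat \<Rightarrow> 'k::field nc_poly) \<Rightarrow> 'k nc_poly \<Rightarrow> 'k nc_poly" where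
  "subst s p = (\<Sum>w\<in>keys p. single [] (lookup p w) * prod_list (map s w))"

lemma subst_zero [simp]: "subst s 0 = 0"
  by (simp add: subst_def)

lemma subst_superset:
  assumes "finite S" "keys p \<subseteq> S"
  shows "subst s p = (\<Sum>w\<in>S. single [] (lookup p w) * prod_list (map s w))"
  unfolding subst_def using assms
  by (intro sum.mono_neutral_left) (auto simp: in_keys_iff)

lemma subst_add: "subst s (p + q) = subst s p + subst s q"
proof -
  let ?S = "keys p \<union> keys q"
  have "keys (p + q) \<subseteq> ?S" by (rule keys_add)
  then show ?thesis
    using subst_superset[of ?S p s] subst_superset[of ?S q s] subst_superset[of ?S "p + q" s]
    by (simp add: lookup_add single_add distrib_right sum.distrib)
qed

lemma subst_single: "subst s (single w c) = single [] c * prod_list (map s w)"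
  by (simp add: subst_superset[of "{w}"])

lemma subst_X [simp]: "subst s (X i) = s i"
  by (simp add: X_def subst_single)

lemma subst_mult: "subst s (p * q) = subst s p * subst s q"
proof (induction p rule: nc_poly_induct)
  case (add p w c)
  have "subst s (single w c * q) = subst s (single w c) * subst s q"
  proof (induction q rule: nc_poly_induct)
    case (add q v b)
    have "single [] (c * b) * (P * Q) = single [] c * P * (single [] b * Q)" for P Q :: "'a nc_poly"
    proof -
      have "single [] c * P * (single [] b * Q) = single [] c * (P * single [] b) * Q"
        by (simp only: mult.assoc)
      also have "\<dots> = single [] c * single [] b * (P * Q)"
        by (simp only: const_mult_commute[of P b] mult.assoc)
      also have "single [] c * single [] b = single [] (c * b)"
        by (simp add: single_mult_single)
      finally show ?thesis ..
    qed
    then have "subst s (single w c * single v b) = subst s (single w c) * subst s (single v b)"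
      by (simp add: subst_single single_mult_single)
    with add show ?case by (simp add: distrib_left subst_add)
  qed simp
  with add show ?case by (simp add: distrib_right subst_add)
qed simp

lemma subst_const_mult: "subst s (single [] c * p) = single [] c * subst s p"
  by (simp add: subst_mult subst_single)

lemma subst_minus: "subst s (p - q) = subst s p - subst s q"
  using subst_add[of s "p - q" q] by simp

lemma subst_comm: "subst s (comm p q) = comm (subst s p) (subst s q)"
  by (simp add: comm_def subst_minus subst_mult)

lemma prod_list_carr:
  "w \<noteq> [] \<Longrightarrow> (\<And>i. i \<in> set w \<Longrightarrow> s i \<in> carr free_alg) \<Longrightarrow> prod_list (map s w) \<in> carr free_alg"
  by (cases w) auto

lemma subst_carr:
  assumes "p \<in> carr free_alg" "\<And>i. s i \<in> carr free_alg"
  shows "subst s p \<in> carr free_alg"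
  using assms(1)
  by (induction p rule: carr_induct) (auto simp: subst_add subst_single intro!: prod_list_carr assms(2))

lemma subst_alg_hom:
  assumes "\<And>i. s i \<in> carr free_alg"
  shows "subst s \<in> alg_hom free_alg free_alg"
  using assms by (auto simp: alg_hom_def subst_carr subst_add subst_mult subst_const_mult subst_single)

lemma single_eq_prod: "single w c = single [] c * prod_list (map X w)" for c :: "'k::field"
proof (induction w arbitrary: c)
  case (Cons i w)
  have "single (i # w) c = single [] c * (X i * single w 1)"
    by (simp add: X_def single_mult_single)
  then show ?case using Cons[of 1] by simp
qed (simp)

text \<open>The target is a bare record: the values on the \<open>X i\<close> and the three
  operations determine everything. Quotients can therefore serve as targets directly.\<close>

lemma alg_hom_eq_on_carr:
  fixes \<phi> \<psi> :: "'k::field nc_poly \<Rightarrow> 'b"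
  assumes \<phi>: "\<phi> \<in> alg_hom free_alg B" and \<psi>: "\<psi> \<in> alg_hom free_alg B"
    and eq: "\<And>i. \<phi> (X i) = \<psi> (X i)" and p: "p \<in> carr free_alg"
  shows "\<phi> p = \<psi> p"
  using p
proof (induction p rule: carr_induct)
  case zero
  \<comment> \<open>\<open>alg_hom\<close> does not mention zero, so zero is written as a scalar
    multiple of a generator.\<close>
  have "\<phi> (scal free_alg 0 (X 0)) = \<psi> (scal free_alg 0 (X 0))"
    using \<phi> \<psi> eq unfolding alg_hom_def by (simp del: free_alg_simps)
  then show ?case by simp
next
  case (add p w c)
  have *: "\<phi> (prod_list (map X w)) = \<psi> (prod_list (map X w))"
    using \<open>w \<noteq> []\<close>
  proof (induction w rule: list_nonempty_induct)
    case (cons i w)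
    have "prod_list (map X w) \<in> (carr free_alg :: 'k nc_poly set)"
      using cons by (intro prod_list_carr) auto
    then have "\<phi> (mul free_alg (X i) (prod_list (map X w)))
      = \<psi> (mul free_alg (X i) (prod_list (map X w)))"
      using \<phi> \<psi> eq cons unfolding alg_hom_def by (simp del: free_alg_simps)
    then show ?case by simp
  qed (use eq in simp)
  have "prod_list (map X w) \<in> (carr free_alg :: 'k nc_poly set)"
    using add by (intro prod_list_carr) auto
  then have "\<phi> (scal free_alg c (prod_list (map X w))) = \<psi> (scal free_alg c (prod_list (map X w)))"
    using \<phi> \<psi> * unfolding alg_hom_def by (simp del: free_alg_simps)
  then have "\<phi> (single w c) = \<psi> (single w c)" by (simp flip: single_eq_prod)
  moreover have hom_add: "\<chi> (p + single w c) = add B (\<chi> p) (\<chi> (single w c))"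
    if "\<chi> \<in> alg_hom free_alg B" for \<chi>
    using that add carr_free_algI(9)[of w c] unfolding alg_hom_def by simp
  ultimately show ?case by (simp add: add.IH hom_add[OF \<phi>] hom_add[OF \<psi>])
qed

lemma alg_hom_free_eq_subst:
  assumes "\<phi> \<in> alg_hom free_alg free_alg" "p \<in> carr free_alg"
  shows "\<phi> p = subst (\<phi> \<circ> X) p"
  using assms
  by (intro alg_hom_eq_on_carr[OF assms(1) subst_alg_hom _ assms(2)]) (auto simp: alg_hom_def)

section \<open>Gradings of T-ideals\<close>

text \<open>Projection onto the span of the words satisfying \<open>Q\<close>. Homogeneous
  components, truncations by degree and multilinear components are all instances.\<close>

definition part :: "(nat list \<Rightarrow> bool) \<Rightarrow> 'k::field nc_poly \<Rightarrow> 'k nc_poly" where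
  "part Q p = (\<Sum>w | w \<in> keys p \<and> Q w. single w (lookup p w))"

lemma lookup_part: "lookup (part Q p) w = (if Q w then lookup p w else 0)"
proof -
  have "lookup (part Q p) w = (\<Sum>v | v \<in> keys p \<and> Q v. if v = w then lookup p v else 0)"
    unfolding part_def lookup_sum by (intro sum.cong) (auto simp: lookup_single when_def)
  also have "\<dots> = (if Q w then lookup p w else 0)"
    by (simp add: sum.delta in_keys_iff)
  finally show ?thesis .
qed

lemma hom_part_eq: "hom_part d p = part (\<lambda>w. length w = d) p"
  by (simp add: hom_part_def part_def)

lemma part_add: "part Q (p + q) = part Q p + part Q q"
  by (rule poly_mapping_eqI) (simp add: lookup_part lookup_add)

lemma part_minus: "part Q (p - q) = part Q p - part Q q"
  by (rule poly_mapping_eqI) (simp add: lookup_part lookup_minus)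

lemma part_const_mult: "part Q (single [] c * p) = single [] c * part Q p"
  by (rule poly_mapping_eqI) (simp add: lookup_part)

lemma part_single: "part Q (single w c) = (if Q w then single w c else 0)"
  by (rule poly_mapping_eqI) (simp add: lookup_part lookup_single when_def)

lemma part_part: "part Q (part R p) = part (\<lambda>w. R w \<and> Q w) p"
  by (rule poly_mapping_eqI) (simp add: lookup_part)

lemma part_id: "(\<And>w. w \<in> keys p \<Longrightarrow> Q w) \<Longrightarrow> part Q p = p"
  by (rule poly_mapping_eqI) (auto simp: lookup_part in_keys_iff)

lemma part_zero [simp]: "part Q 0 = 0"
  by (rule poly_mapping_eqI) (simp add: lookup_part)

lemma part_sum: "part Q (\<Sum>x\<in>S. f x) = (\<Sum>x\<in>S. part Q (f x))"
  by (induction S rule: infinite_finite_induct) (simp_all add: part_add)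

lemma single_Nil_numeral: "single [] (numeral k :: 'k::field) = (numeral k :: 'k nc_poly)"
  by (simp flip: zero_list_def)

locale free_t_ideal =
  fixes I :: "'k::field_char_0 nc_poly set"
  assumes I: "t_ideal free_alg I"
begin

lemma carr: "p \<in> I \<Longrightarrow> p \<in> carr free_alg"
  and zero [simp]: "0 \<in> I"
  and add: "p \<in> I \<Longrightarrow> q \<in> I \<Longrightarrow> p + q \<in> I"
  and scal: "p \<in> I \<Longrightarrow> single [] c * p \<in> I"
  and mult_right: "p \<in> I \<Longrightarrow> r \<in> carr free_alg \<Longrightarrow> p * r \<in> I"
  and mult_left: "p \<in> I \<Longrightarrow> r \<in> carr free_alg \<Longrightarrow> r * p \<in> I"
  and hom: "p \<in> I \<Longrightarrow> \<phi> \<in> alg_hom free_alg free_alg \<Longrightarrow> \<phi> p \<in> I"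
  using I by (simp_all add: t_ideal_def image_subset_iff subset_iff)

lemma subst: "p \<in> I \<Longrightarrow> (\<And>i. s i \<in> carr free_alg) \<Longrightarrow> subst s p \<in> I"
  by (rule hom[OF _ subst_alg_hom])

lemma uminus: "p \<in> I \<Longrightarrow> - p \<in> I"
  using scal[of p "-1"] by (simp add: single_uminus)

lemma diff: "p \<in> I \<Longrightarrow> q \<in> I \<Longrightarrow> p - q \<in> I"
  using add[of p "- q"] uminus by simp

lemma sum: "(\<And>x. x \<in> S \<Longrightarrow> f x \<in> I) \<Longrightarrow> (\<Sum>x\<in>S. f x) \<in> I"
  by (induction S rule: infinite_finite_induct) (auto simp: add)

lemma scal_cancel:
  assumes "single [] c * p \<in> I" "c \<noteq> 0"
  shows "p \<in> I"
  using scal[OF assms(1), of "1 / c"] assms(2)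
  by (simp add: single_mult_single flip: mult.assoc)

lemma numeral: "p \<in> I \<Longrightarrow> numeral k * p \<in> I"
  using scal[of p "numeral k"] by (simp add: single_Nil_numeral)

lemma numeral_cancel: "numeral k * p \<in> I \<Longrightarrow> p \<in> I"
  using scal_cancel[of "numeral k" p] by (simp add: single_Nil_numeral)

text \<open>Rescaling the variable \<open>X i\<close> by \<open>2 ^ v i\<close> multiplies the component of weight \<open>d\<close> by \<open>2 ^ d\<close>;
  the eigenvalues are distinct in characteristic 0.\<close>

lemma part_weight:
  fixes v :: "nat \<Rightarrow> nat"
  assumes "p \<in> I"
  shows "part (\<lambda>w. sum_list (map v w) = d) p \<in> I"
proof -
  let ?wt = "\<lambda>w. sum_list (map v w)"
  let ?D = "subst (\<lambda>i. single [i] (2 ^ v i))"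
  have D_prod: "prod_list (map (\<lambda>i. single [i] (2 ^ v i)) w) = single w (2 ^ ?wt w :: 'k)" for w
    by (induction w) (simp_all add: single_mult_single power_add)
  have D: "lookup (?D p) w = 2 ^ ?wt w * lookup p w" for p :: "'k nc_poly" and w
    by (induction p rule: nc_poly_induct)
      (simp_all add: subst_add subst_single D_prod lookup_add single_mult_single lookup_single
        when_def algebra_simps)
  have main: "\<forall>w\<in>keys p. ?wt w < N \<Longrightarrow> p \<in> I \<Longrightarrow> part (\<lambda>w. ?wt w = d) p \<in> I" for N p d
  proof (induction N arbitrary: p d)
    case 0
    then have "keys p = {}" by auto
    then show ?case by (simp add: part_def)
  next
    case (Suc N)
    \<comment> \<open>This combination has no component of weight \<open>N\<close> and multiplies
      the one of weight \<open>e\<close> by \<open>2 ^ e - 2 ^ N\<close>, so the induction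
      hypothesis applies to it.\<close>
    define q where "q = ?D p - single [] (2 ^ N) * p"
    have q: "lookup q w = (2 ^ ?wt w - 2 ^ N) * lookup p w" for w
      by (simp add: q_def lookup_minus D algebra_simps)
    have "q \<in> I"
      unfolding q_def using Suc.prems by (intro diff subst scal) auto
    moreover have "\<forall>w\<in>keys q. ?wt w < N"
    proof
      fix w assume "w \<in> keys q"
      then have "w \<in> keys p" "?wt w \<noteq> N" by (auto simp: in_keys_iff q)
      then show "?wt w < N" using Suc.prems(1) by force
    qed
    ultimately have part_q: "part (\<lambda>w. ?wt w = e) q \<in> I" for e by (intro Suc.IH)
    have low: "part (\<lambda>w. ?wt w = e) p \<in> I" if "e < N" for e
    proof (rule scal_cancel)
      have "part (\<lambda>w. ?wt w = e) q = single [] (2 ^ e - 2 ^ N) * part (\<lambda>w. ?wt w = e) p"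
        by (rule poly_mapping_eqI) (simp add: lookup_part q)
      with part_q show "single [] (2 ^ e - 2 ^ N) * part (\<lambda>w. ?wt w = e) p \<in> I" by metis
      have "of_nat (2 ^ e) \<noteq> (of_nat (2 ^ N) :: 'k)"
        unfolding of_nat_eq_iff using that by simp
      then show "2 ^ e - 2 ^ N \<noteq> (0 :: 'k)" by simp
    qed
    show ?case
    proof (cases "d < N")
      case False
      have "part (\<lambda>w. ?wt w = d) p = 0" if "d \<noteq> N"
        using Suc.prems(1) False that by (intro poly_mapping_eqI) (force simp: lookup_part in_keys_iff)
      \<comment> \<open>The top weight \<open>N\<close> is what remains after the lower components
        are removed.\<close>
      moreover have "part (\<lambda>w. ?wt w = N) p = p - (\<Sum>e<N. part (\<lambda>w. ?wt w = e) p)"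
      proof (rule poly_mapping_eqI)
        fix w
        have "(\<Sum>e<N. if ?wt w = e then lookup p w else 0) = (if ?wt w < N then lookup p w else 0)"
          by simp
        moreover have "lookup p w = 0 \<or> ?wt w < Suc N" using Suc.prems(1) by (auto simp: in_keys_iff)
        ultimately show "lookup (part (\<lambda>w. ?wt w = N) p) w = lookup (p - (\<Sum>e<N. part (\<lambda>w. ?wt w = e) p)) w"
          by (auto simp: lookup_part lookup_minus lookup_sum)
      qed
      then have "part (\<lambda>w. ?wt w = N) p \<in> I" using Suc.prems(2) low by (auto intro: diff sum)
      ultimately show ?thesis by (cases "d = N") auto
    qed (rule low)
  qed
  obtain N where "\<forall>w\<in>keys p. ?wt w < N"
    using finite_nat_set_iff_bounded[of "?wt ` keys p"] by auto
  then show ?thesis using assms by (rule main)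
qed

lemma hom_part: "p \<in> I \<Longrightarrow> hom_part d p \<in> I"
  using part_weight[of p "\<lambda>_. 1" d] by (simp add: hom_part_eq sum_list_triv)

end

section \<open>T-ideals of quotients of the free algebra\<close>

lemma t_ideal_gen_least: "t_ideal B J \<Longrightarrow> S \<subseteq> J \<Longrightarrow> t_ideal_gen B S \<subseteq> J"
  by (auto simp: t_ideal_gen_def)

lemma t_ideal_gen_superset: "S \<subseteq> t_ideal_gen B S"
  by (auto simp: t_ideal_gen_def)

lemma t_ideal_Inter:
  assumes "\<And>J. J \<in> \<J> \<Longrightarrow> t_ideal B J" "\<J> \<noteq> {}"
  shows "t_ideal B (\<Inter>\<J>)"
  unfolding t_ideal_def
proof (intro conjI)
  show "\<forall>\<phi>\<in>alg_hom B B. \<phi> ` \<Inter>\<J> \<subseteq> \<Inter>\<J>"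
    using assms(1) unfolding t_ideal_def by blast
qed (use assms in \<open>unfold t_ideal_def, blast+\<close>)

lemma t_ideal_carr_free: "t_ideal free_alg (carr free_alg)"
  by (auto simp: t_ideal_def alg_hom_def)

lemma free_t_ideal_gen:
  fixes S :: "'k::field_char_0 nc_poly set"
  assumes "S \<subseteq> carr free_alg"
  shows "free_t_ideal (t_ideal_gen free_alg S)"
  unfolding free_t_ideal_def t_ideal_gen_def
  by (rule t_ideal_Inter) (use assms t_ideal_carr_free in auto)

lemma alg_hom_closed: "\<phi> \<in> alg_hom B C \<Longrightarrow> a \<in> carr B \<Longrightarrow> \<phi> a \<in> carr C"
  by (auto simp: alg_hom_def)

lemma alg_hom_comp:
  "\<phi> \<in> alg_hom B C \<Longrightarrow> \<psi> \<in> alg_hom C D \<Longrightarrow> (\<lambda>a. \<psi> (\<phi> a)) \<in> alg_hom B D"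
  by (simp add: alg_hom_def image_subset_iff)

context free_t_ideal
begin

lemma mem_coset: "q \<in> coset free_alg I p \<longleftrightarrow> q - p \<in> I"
proof
  assume "q - p \<in> I"
  then have "\<exists>j\<in>I. q = p + j" by (intro bexI[of _ "q - p"]) auto
  then show "q \<in> coset free_alg I p" by (auto simp: coset_def)
qed (auto simp: coset_def)

lemma coset_eq_iff: "coset free_alg I p = coset free_alg I q \<longleftrightarrow> p - q \<in> I"
proof
  assume "coset free_alg I p = coset free_alg I q"
  moreover have "p \<in> coset free_alg I p" by (simp add: mem_coset)
  ultimately show "p - q \<in> I" by (simp add: mem_coset)
next
  assume *: "p - q \<in> I"
  have "r - p \<in> I \<longleftrightarrow> r - q \<in> I" for r
    using add[OF _ *, of "r - p"] diff[OF _ *, of "r - q"] by auto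
  then show "coset free_alg I p = coset free_alg I q" by (auto simp: mem_coset)
qed

lemma self_coset: "p \<in> coset free_alg I p"
  by (simp add: mem_coset)

text \<open>The operations of \<open>quot_alg\<close> are unions over all representatives; once
  independence of the representative is known, such a union over a nonempty coset collapses to the
  common value.\<close>

lemma UN_coset_eq:
  assumes "\<And>x. x \<in> coset free_alg I p \<Longrightarrow> f x = f p"
  shows "(\<Union>x\<in>coset free_alg I p. f x) = f p"
  using assms self_coset by blast

lemma UN_UN_coset_eq:
  assumes "\<And>x y. x \<in> coset free_alg I p \<Longrightarrow> y \<in> coset free_alg I q \<Longrightarrow> f x y = f p q"
  shows "(\<Union>x\<in>coset free_alg I p. \<Union>y\<in>coset free_alg I q. f x y) = f p q"
  using assms self_coset by blast

lemma quot_carr: "carr (quot_alg free_alg I) = coset free_alg I ` carr free_alg"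
  by (simp add: quot_alg_def)

lemma quot_zer: "zer (quot_alg free_alg I) = coset free_alg I 0"
  by (simp add: quot_alg_def)

lemma quot_add: "add (quot_alg free_alg I) (coset free_alg I p) (coset free_alg I q) = coset free_alg I (p + q)"
proof -
  have "coset free_alg I (x + y) = coset free_alg I (p + q)"
    if "x \<in> coset free_alg I p" "y \<in> coset free_alg I q" for x y
    using add[of "x - p" "y - q"] that by (simp add: mem_coset coset_eq_iff algebra_simps)
  from UN_UN_coset_eq[where f = "\<lambda>x y. coset free_alg I (x + y)", OF this]
  show ?thesis by (simp add: quot_alg_def)
qed

lemma quot_mul:
  assumes "p \<in> carr free_alg" "q \<in> carr free_alg"
  shows "mul (quot_alg free_alg I) (coset free_alg I p) (coset free_alg I q) = coset free_alg I (p * q)"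
proof -
  have "coset free_alg I (x * y) = coset free_alg I (p * q)"
    if "x \<in> coset free_alg I p" "y \<in> coset free_alg I q" for x y
  proof -
    have "x - p \<in> I" "y - q \<in> I" using that by (auto simp: mem_coset)
    moreover from this have "y \<in> carr free_alg"
      using carr_free_algI(3)[of "y - q" q] carr assms by simp
    \<comment> \<open>The sum equals \<open>x * y - p * q\<close>. The outer factors must lie in the
      carrier because \<open>I\<close> is an ideal of the nonunital algebra.\<close>
    ultimately have "(x - p) * y + p * (y - q) \<in> I"
      using assms by (intro add mult_left mult_right)
    then show ?thesis by (simp add: coset_eq_iff algebra_simps)
  qed
  from UN_UN_coset_eq[where f = "\<lambda>x y. coset free_alg I (x * y)", OF this]
  show ?thesis by (simp add: quot_alg_def)
qed

lemma quot_scal: "scal (quot_alg free_alg I) c (coset free_alg I p) = coset free_alg I (single [] c * p)"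
proof -
  have "coset free_alg I (single [] c * x) = coset free_alg I (single [] c * p)"
    if "x \<in> coset free_alg I p" for x
    using scal[of "x - p" c] that by (simp add: mem_coset coset_eq_iff algebra_simps)
  from UN_coset_eq[where f = "\<lambda>x. coset free_alg I (single [] c * x)", OF this]
  show ?thesis by (simp add: quot_alg_def)
qed

lemma coset_alg_hom: "coset free_alg I \<in> alg_hom free_alg (quot_alg free_alg I)"
  by (auto simp: alg_hom_def quot_carr quot_add quot_mul quot_scal)

text \<open>Freeness: representatives of the images of the generators give a substitution, and the
  two resulting homomorphisms into the quotient agree on generators.\<close>

lemma quot_hom_lift:
  assumes "\<psi> \<in> alg_hom (quot_alg free_alg I) (quot_alg free_alg I)"
  obtains s where "\<And>i. s i \<in> carr free_alg"
    and "\<And>p. p \<in> carr free_alg \<Longrightarrow> \<psi> (coset free_alg I p) = coset free_alg I (subst s p)"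
proof -
  have "\<exists>q\<in>carr free_alg. \<psi> (coset free_alg I (X i)) = coset free_alg I q" for i
    using alg_hom_closed[OF assms, of "coset free_alg I (X i)"] by (auto simp: quot_carr)
  then obtain s where s: "\<And>i. s i \<in> carr free_alg"
    "\<And>i. \<psi> (coset free_alg I (X i)) = coset free_alg I (s i)" by metis
  have "(\<lambda>p. \<psi> (coset free_alg I p)) \<in> alg_hom free_alg (quot_alg free_alg I)"
    using coset_alg_hom assms by (rule alg_hom_comp)
  moreover have "(\<lambda>p. coset free_alg I (subst s p)) \<in> alg_hom free_alg (quot_alg free_alg I)"
    using subst_alg_hom[OF s(1)] coset_alg_hom by (rule alg_hom_comp)
  ultimately have "\<psi> (coset free_alg I p) = coset free_alg I (subst s p)" if "p \<in> carr free_alg" for p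
    by (rule alg_hom_eq_on_carr) (simp_all add: s that)
  with s(1) show ?thesis by (rule that)
qed

text \<open>A substitution descends because it maps the T-ideal \<open>I\<close> into
  itself.\<close>

lemma quot_hom_descend:
  assumes s: "\<And>i. s i \<in> carr free_alg"
  obtains \<psi> where "\<psi> \<in> alg_hom (quot_alg free_alg I) (quot_alg free_alg I)"
    and "\<And>p. p \<in> carr free_alg \<Longrightarrow> \<psi> (coset free_alg I p) = coset free_alg I (subst s p)"
proof -
  \<comment> \<open>An arbitrary representative is taken; the next fact shows that the choice does
    not matter.\<close>
  define \<psi> where "\<psi> U = coset free_alg I (subst s (SOME p. p \<in> U))" for U
  have \<psi>: "\<psi> (coset free_alg I p) = coset free_alg I (subst s p)" for p
  proof -
    have "(SOME q. q \<in> coset free_alg I p) \<in> coset free_alg I p"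
      using self_coset by (rule someI)
    then have "subst s ((SOME q. q \<in> coset free_alg I p) - p) \<in> I"
      unfolding mem_coset using s by (rule subst)
    then show ?thesis by (simp add: \<psi>_def coset_eq_iff subst_minus)
  qed
  have "\<psi> \<in> alg_hom (quot_alg free_alg I) (quot_alg free_alg I)"
    by (auto simp: alg_hom_def quot_carr quot_add quot_mul quot_scal \<psi> subst_add
        subst_mult subst_single subst_carr s)
  then show ?thesis using \<psi> by (rule that)
qed

text \<open>Invariance of the preimage is tested on endomorphisms of the free algebra, which have to
  descend before the invariance of \<open>J\<close> applies.\<close>

lemma t_ideal_vimage_coset:
  assumes "t_ideal (quot_alg free_alg I) J"
  shows "t_ideal free_alg {p \<in> carr free_alg. coset free_alg I p \<in> J}"
proof -
  let ?F = "quot_alg free_alg I"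
  have J: "coset free_alg I 0 \<in> J"
    "\<And>U V. U \<in> J \<Longrightarrow> V \<in> J \<Longrightarrow> add ?F U V \<in> J"
    "\<And>U c. U \<in> J \<Longrightarrow> scal ?F c U \<in> J"
    "\<And>U V. U \<in> J \<Longrightarrow> V \<in> carr ?F \<Longrightarrow> mul ?F U V \<in> J"
    "\<And>U V. U \<in> J \<Longrightarrow> V \<in> carr ?F \<Longrightarrow> mul ?F V U \<in> J"
    "\<And>\<psi>. \<psi> \<in> alg_hom ?F ?F \<Longrightarrow> \<psi> ` J \<subseteq> J"
    using assms unfolding t_ideal_def quot_zer by simp_all
  let ?J = "{p \<in> carr free_alg. coset free_alg I p \<in> J}"
  have carr_J: "coset free_alg I p \<in> carr ?F" if "p \<in> carr free_alg" for p
    using that by (simp add: quot_carr)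
  show ?thesis
    unfolding t_ideal_def
  proof (intro conjI ballI allI)
    fix \<phi> :: "'k nc_poly \<Rightarrow> 'k nc_poly" assume \<phi>: "\<phi> \<in> alg_hom free_alg free_alg"
    then have s: "(\<phi> \<circ> X) i \<in> carr free_alg" for i by (simp add: alg_hom_closed)
    obtain \<psi> where \<psi>: "\<psi> \<in> alg_hom ?F ?F"
      "\<And>p. p \<in> carr free_alg \<Longrightarrow> \<psi> (coset free_alg I p) = coset free_alg I (subst (\<phi> \<circ> X) p)"
      by (rule quot_hom_descend[where s = "\<phi> \<circ> X", OF s]) (rule that; assumption)
    have "coset free_alg I (\<phi> p) \<in> J" if "p \<in> carr free_alg" "coset free_alg I p \<in> J" for p
    proof -
      have "coset free_alg I (\<phi> p) = \<psi> (coset free_alg I p)"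
        using \<psi>(2)[OF that(1)] alg_hom_free_eq_subst[OF \<phi> that(1)] by simp
      then show ?thesis using J(6)[OF \<psi>(1)] that(2) by auto
    qed
    then show "\<phi> ` ?J \<subseteq> ?J" using alg_hom_closed[OF \<phi>] by auto
  next
    fix p q :: "'k nc_poly" assume "p \<in> ?J" "q \<in> carr free_alg"
    then show "mul free_alg p q \<in> ?J" "mul free_alg q p \<in> ?J"
      using J(4,5)[of "coset free_alg I p" "coset free_alg I q"] carr_J by (simp_all add: quot_mul)
  next
    fix p q :: "'k nc_poly" assume "p \<in> ?J" "q \<in> ?J"
    then show "add free_alg p q \<in> ?J"
      using J(2)[of "coset free_alg I p" "coset free_alg I q"] by (simp add: quot_add)
  next
    fix p :: "'k nc_poly" and c assume "p \<in> ?J"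
    then show "scal free_alg c p \<in> ?J"
      using J(3)[of "coset free_alg I p" c] by (simp add: quot_scal)
  qed (use J(1) in auto)
qed

text \<open>In this direction endomorphisms of the quotient have to be lifted.\<close>

lemma t_ideal_image_coset:
  assumes "t_ideal free_alg J"
  shows "t_ideal (quot_alg free_alg I) (coset free_alg I ` J)"
proof -
  interpret J: free_t_ideal J using assms by unfold_locales
  show ?thesis
    unfolding t_ideal_def
  proof (intro conjI ballI allI)
    fix \<psi> assume "\<psi> \<in> alg_hom (quot_alg free_alg I) (quot_alg free_alg I)"
    then obtain s where s: "\<And>i. s i \<in> carr free_alg"
      "\<And>p. p \<in> carr free_alg \<Longrightarrow> \<psi> (coset free_alg I p) = coset free_alg I (subst s p)"
      by (rule quot_hom_lift) (rule that; assumption)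
    show "\<psi> ` coset free_alg I ` J \<subseteq> coset free_alg I ` J"
      unfolding image_image
    proof (rule image_subsetI)
      fix p assume p: "p \<in> J"
      have "coset free_alg I (subst s p) \<in> coset free_alg I ` J"
        using J.subst[OF p s(1)] by (rule imageI)
      then show "\<psi> (coset free_alg I p) \<in> coset free_alg I ` J"
        using s(2)[OF J.carr[OF p]] by simp
    qed
  next
    fix U V assume "U \<in> coset free_alg I ` J" "V \<in> carr (quot_alg free_alg I)"
    then obtain p q where pq: "U = coset free_alg I p" "V = coset free_alg I q" "p \<in> J" "q \<in> carr free_alg"
      by (auto simp: quot_carr)
    have "coset free_alg I (p * q) \<in> coset free_alg I ` J" "coset free_alg I (q * p) \<in> coset free_alg I ` J"
      using J.mult_right[OF pq(3,4)] J.mult_left[OF pq(3,4)] by (simp_all only: imageI)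
    then show "mul (quot_alg free_alg I) U V \<in> coset free_alg I ` J"
      "mul (quot_alg free_alg I) V U \<in> coset free_alg I ` J"
      using pq J.carr by (simp_all add: quot_mul)
  next
    fix U V assume "U \<in> coset free_alg I ` J" "V \<in> coset free_alg I ` J"
    then obtain p q where pq: "U = coset free_alg I p" "V = coset free_alg I q" "p \<in> J" "q \<in> J"
      by blast
    have "coset free_alg I (p + q) \<in> coset free_alg I ` J"
      using pq by (intro imageI J.add)
    then show "add (quot_alg free_alg I) U V \<in> coset free_alg I ` J"
      using pq by (simp add: quot_add)
  next
    fix U c assume "U \<in> coset free_alg I ` J"
    then obtain p where p: "U = coset free_alg I p" "p \<in> J" by blast
    have "coset free_alg I (single [] c * p) \<in> coset free_alg I ` J"
      using p by (intro imageI J.scal)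
    then show "scal (quot_alg free_alg I) c U \<in> coset free_alg I ` J"
      using p by (simp add: quot_scal)
  next
    show "coset free_alg I ` J \<subseteq> carr (quot_alg free_alg I)"
      unfolding quot_carr using J.carr by (intro image_mono subsetI)
    show "zer (quot_alg free_alg I) \<in> coset free_alg I ` J"
      unfolding quot_zer by (intro imageI J.zero)
  qed
qed

text \<open>This moves all computations with consequences from the quotient to the free algebra, at
  the price of adding \<open>I\<close> to the generators.\<close>

lemma t_ideal_gen_quot:
  assumes "f \<in> carr free_alg"
  shows "t_ideal_gen (quot_alg free_alg I) {coset free_alg I f}
    = coset free_alg I ` t_ideal_gen free_alg (insert f I)"
proof
  interpret G: free_t_ideal "t_ideal_gen free_alg (insert f I)"
    using assms carr by (intro free_t_ideal_gen) blast
  have "f \<in> t_ideal_gen free_alg (insert f I)"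
    using t_ideal_gen_superset[of "insert f I" free_alg] by blast
  then show "t_ideal_gen (quot_alg free_alg I) {coset free_alg I f}
      \<subseteq> coset free_alg I ` t_ideal_gen free_alg (insert f I)"
    by (intro t_ideal_gen_least t_ideal_image_coset G.I) blast
  show "coset free_alg I ` t_ideal_gen free_alg (insert f I)
      \<subseteq> t_ideal_gen (quot_alg free_alg I) {coset free_alg I f}"
  proof (rule image_subsetI)
    fix p assume p: "p \<in> t_ideal_gen free_alg (insert f I)"
    have "coset free_alg I p \<in> J"
      if J: "t_ideal (quot_alg free_alg I) J" "coset free_alg I f \<in> J" for J
    proof -
      have "coset free_alg I i \<in> J" if "i \<in> I" for i
      proof -
        have "coset free_alg I i = zer (quot_alg free_alg I)"
          using that by (simp add: quot_zer coset_eq_iff)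
        then show ?thesis using J(1) by (simp add: t_ideal_def)
      qed
      then have "insert f I \<subseteq> {p \<in> carr free_alg. coset free_alg I p \<in> J}"
        using J(2) assms carr by blast
      then have "t_ideal_gen free_alg (insert f I) \<subseteq> {p \<in> carr free_alg. coset free_alg I p \<in> J}"
        by (intro t_ideal_gen_least t_ideal_vimage_coset J(1))
      then show ?thesis using p by blast
    qed
    then show "coset free_alg I p \<in> t_ideal_gen (quot_alg free_alg I) {coset free_alg I f}"
      by (simp add: t_ideal_gen_def)
  qed
qed

end

section \<open>Elements of high degree\<close>

lemma keys_mult_length:
  fixes p q :: "'k::field nc_poly"
  assumes "\<And>w. w \<in> keys p \<Longrightarrow> m \<le> length w" "\<And>w. w \<in> keys q \<Longrightarrow> n \<le> length w" "w \<in> keys (p * q)"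
  shows "m + n \<le> length w"
proof -
  obtain u v where "w = u @ v" "u \<in> keys p" "v \<in> keys q"
    using assms(3) keys_mult[of p q] by (auto simp: plus_list_def)
  then show ?thesis using assms(1)[of u] assms(2)[of v] by simp
qed

lemma keys_prod_list_length:
  fixes s :: "nat \<Rightarrow> 'k::field nc_poly"
  assumes "\<And>i. s i \<in> carr free_alg"
  shows "v \<in> keys (prod_list (map s w)) \<Longrightarrow> length w \<le> length v"
proof (induction w arbitrary: v)
  case (Cons i w)
  have "1 + length w \<le> length v"
    by (rule keys_mult_length[of "s i" _ "prod_list (map s w)"])
      (use Cons keys_carr[OF assms, of _ i] in \<open>auto simp: Suc_le_eq\<close>)
  then show ?case by simp
qed simp

text \<open>In the absence of constant terms, each letter is replaced by words of length at least
  1.\<close>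

lemma keys_subst_length:
  fixes p :: "'k::field nc_poly"
  assumes s: "\<And>i. s i \<in> carr free_alg" and "\<And>w. w \<in> keys p \<Longrightarrow> n \<le> length w"
    and v: "v \<in> keys (subst s p)"
  shows "n \<le> length v"
proof -
  obtain w where "w \<in> keys p" "v \<in> keys (single [] (lookup p w) * prod_list (map s w))"
    using subsetD[OF keys_sum v[unfolded subst_def]] by blast
  then show ?thesis
    using assms(2)[of w] keys_prod_list_length[where s = s and v = v and w = w, OF s] by (auto simp: in_keys_iff)
qed

lemma part_le_eq_sum: "part (\<lambda>w. length w \<le> n) p = (\<Sum>d\<le>n. hom_part d p)"
  by (rule poly_mapping_eqI) (simp add: lookup_part lookup_sum hom_part_eq)

context free_t_ideal
begin

lemma part_le: "p \<in> I \<Longrightarrow> part (\<lambda>w. length w \<le> n) p \<in> I"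
  unfolding part_le_eq_sum by (intro sum hom_part)

text \<open>Multiplications and substitutions never shorten words, so modulo \<open>I\<close> the
  low part of the result depends only on the low part of \<open>p\<close>. The set contains every
  polynomial whose words are all longer than \<open>n\<close>, hence also all consequences of such a
  polynomial.\<close>

lemma t_ideal_high:
  "t_ideal free_alg {p \<in> carr free_alg. part (\<lambda>w. length w \<le> n) p \<in> I}"
proof -
  let ?L = "part (\<lambda>w. length w \<le> n)"
  \<comment> \<open>\<open>h\<close> stands for a left or right multiplication or a substitution. It
    sends \<open>p - ?L p\<close>, whose words are longer than \<open>n\<close>, to an element with
    the same property.\<close>
  have L: "?L (h p) \<in> I"
    if "p \<in> carr free_alg" "?L p \<in> I"
      and h_diff: "\<And>p q. h (p - q) = h p - h q"
      and hI: "\<And>p. p \<in> I \<Longrightarrow> h p \<in> I"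
      and h_keys: "\<And>p w. w \<in> keys (h p) \<Longrightarrow> (\<And>v. v \<in> keys p \<Longrightarrow> Suc n \<le> length v) \<Longrightarrow> Suc n \<le> length w"
    for h p
  proof -
    have "Suc n \<le> length w" if "w \<in> keys (h (p - ?L p))" for w
      using that by (rule h_keys) (auto simp: in_keys_iff lookup_minus lookup_part split: if_splits)
    then have "lookup (h (p - ?L p)) w = 0" if "length w \<le> n" for w
      using that by (meson in_keys_iff not_less_eq_eq)
    then have "?L (h (p - ?L p)) = 0"
      by (intro poly_mapping_eqI) (simp add: lookup_part)
    then have "?L (h p) = ?L (h (?L p))" by (simp add: h_diff part_minus)
    then show ?thesis using that by (simp add: part_le)
  qed
  show ?thesis
    unfolding t_ideal_def
  proof (intro conjI ballI allI)
    fix p q :: "'k nc_poly" assume p: "p \<in> {p \<in> carr free_alg. ?L p \<in> I}" and q: "q \<in> carr free_alg"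
    have *: "Suc n \<le> length w"
      if "w \<in> keys (p * q) \<or> w \<in> keys (q * p)" "\<And>v. v \<in> keys p \<Longrightarrow> Suc n \<le> length v" for p and w :: "nat list"
      using that(1)
    proof
      assume "w \<in> keys (p * q)"
      then have "Suc n + 0 \<le> length w" by (rule keys_mult_length[rotated 2]) (use that(2) in auto)
      then show ?thesis by simp
    next
      assume "w \<in> keys (q * p)"
      then have "0 + Suc n \<le> length w" by (rule keys_mult_length[rotated 2]) (use that(2) in auto)
      then show ?thesis by simp
    qed
    show "mul free_alg p q \<in> {p \<in> carr free_alg. ?L p \<in> I}"
      using p q L[of p "\<lambda>p. p * q"] * mult_right by (auto simp: left_diff_distrib)
    show "mul free_alg q p \<in> {p \<in> carr free_alg. ?L p \<in> I}"
      using p q L[of p "\<lambda>p. q * p"] * mult_left by (auto simp: right_diff_distrib)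
  next
    fix \<phi> :: "'k nc_poly \<Rightarrow> 'k nc_poly" assume \<phi>: "\<phi> \<in> alg_hom free_alg free_alg"
    define s where "s = \<phi> \<circ> X"
    have s: "s i \<in> carr free_alg" for i using \<phi> by (simp add: alg_hom_closed s_def)
    have "?L (subst s p) \<in> I" if "p \<in> carr free_alg" "?L p \<in> I" for p
      by (rule L[OF that]) (fact subst_minus, erule subst, rule s, erule keys_subst_length[OF s, rotated], blast)
    then show "\<phi> ` {p \<in> carr free_alg. ?L p \<in> I} \<subseteq> {p \<in> carr free_alg. ?L p \<in> I}"
      using alg_hom_free_eq_subst[OF \<phi>] subst_carr[OF _ s] by (auto simp flip: s_def)
  qed (auto simp: part_add part_const_mult add scal)
qed

end

section \<open>Relatively free algebras\<close>

lemma (in assoc_algebra) scal_zer: "scal B c (zer B) = zer B"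
  using scal_scal[OF zer_closed, of c 0] zero_scal[OF zer_closed] by simp

lemma (in assoc_algebra) mul_zer:
  assumes "b \<in> carr B"
  shows "mul B (zer B) b = zer B" "mul B b (zer B) = zer B"
  using scal_mul[OF zer_closed assms, of 0] mul_scal[OF assms zer_closed, of 0] assms
  by (simp_all add: zero_scal zer_closed mul_closed)

lemma free_t_ideal_identities_of:
  fixes M :: "('k::field_char_0, 'b) alg set"
  assumes "\<And>B. B \<in> M \<Longrightarrow> assoc_algebra B"
  shows "free_t_ideal (identities_of M)"
proof -
  have "t_ideal free_alg (identities_of {B})" if "B \<in> M" for B
  proof -
    interpret assoc_algebra B using assms that .
    have hom_zero: "\<phi> 0 = zer B" if "\<phi> \<in> alg_hom free_alg B" for \<phi> :: "'k nc_poly \<Rightarrow> 'b"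
    proof -
      have "\<phi> (single [] 0 * 0) = scal B 0 (\<phi> 0)" "\<phi> 0 \<in> carr B"
        using that by (auto simp: alg_hom_def simp del: single_zero mult_zero_right)
      then show ?thesis by (simp add: zero_scal)
    qed
    have hom_comp: "\<phi> (\<psi> p) = zer B"
      if "\<psi> \<in> alg_hom free_alg free_alg" "\<phi> \<in> alg_hom free_alg B" "p \<in> identities_of {B}"
      for \<phi> :: "'k nc_poly \<Rightarrow> 'b" and \<psi> p
    proof -
      have "(\<lambda>p. \<phi> (\<psi> p)) \<in> alg_hom free_alg B"
        using that(1,2) by (rule alg_hom_comp)
      then show ?thesis using that(3) by (auto simp: identities_of_def satisfies_def)
    qed
    have mem: "p \<in> identities_of {B} \<longleftrightarrow> p \<in> carr free_alg \<and> (\<forall>\<phi>\<in>alg_hom free_alg B. \<phi> p = zer B)"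
      for p :: "'k nc_poly"
      by (auto simp: identities_of_def satisfies_def)
    show ?thesis
      unfolding t_ideal_def
    proof (intro conjI ballI allI)
      fix \<psi> :: "'k nc_poly \<Rightarrow> 'k nc_poly" assume "\<psi> \<in> alg_hom free_alg free_alg"
      then show "\<psi> ` identities_of {B} \<subseteq> identities_of {B}"
        using hom_comp alg_hom_closed by (fastforce simp: mem)
    next
      fix p q :: "'k nc_poly" assume *: "p \<in> identities_of {B}" "q \<in> identities_of {B}"
      have "\<phi> (p + q) = zer B" if \<phi>: "\<phi> \<in> alg_hom free_alg B" for \<phi>
      proof -
        have "\<phi> p = zer B" "\<phi> q = zer B" using * \<phi> mem by blast+
        moreover have "\<phi> (p + q) = add B (\<phi> p) (\<phi> q)"
          using * \<phi> by (simp add: mem alg_hom_def)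
        ultimately show ?thesis by (simp add: zer_add zer_closed)
      qed
      then show "add free_alg p q \<in> identities_of {B}" using * by (auto simp: mem)
    next
      fix p :: "'k nc_poly" and c assume *: "p \<in> identities_of {B}"
      have "\<phi> (single [] c * p) = zer B" if \<phi>: "\<phi> \<in> alg_hom free_alg B" for \<phi>
      proof -
        have "\<phi> p = zer B" using * \<phi> mem by blast
        moreover have "\<phi> (single [] c * p) = scal B c (\<phi> p)"
          using * \<phi> by (simp add: mem alg_hom_def)
        ultimately show ?thesis by (simp add: scal_zer)
      qed
      then show "scal free_alg c p \<in> identities_of {B}" using * by (auto simp: mem)
    next
      fix p q :: "'k nc_poly" assume *: "p \<in> identities_of {B}" "q \<in> carr free_alg"
      have "\<phi> (p * q) = zer B \<and> \<phi> (q * p) = zer B" if \<phi>: "\<phi> \<in> alg_hom free_alg B" for \<phi>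
      proof -
        have "\<phi> p = zer B" using * \<phi> mem by blast
        moreover have "\<phi> (p * q) = mul B (\<phi> p) (\<phi> q)" "\<phi> (q * p) = mul B (\<phi> q) (\<phi> p)"
          using * \<phi> by (simp_all add: mem alg_hom_def)
        ultimately show ?thesis using alg_hom_closed[OF \<phi> *(2)] by (simp add: mul_zer)
      qed
      then have "\<forall>\<phi>\<in>alg_hom free_alg B. \<phi> (p * q) = zer B" "\<forall>\<phi>\<in>alg_hom free_alg B. \<phi> (q * p) = zer B"
        by blast+
      then show "mul free_alg p q \<in> identities_of {B}" "mul free_alg q p \<in> identities_of {B}"
        unfolding mem using * by simp_all
    qed (auto simp: mem hom_zero)
  qed
  \<comment> \<open>The carrier is inserted so that the intersection is also right for an empty
    \<open>M\<close>.\<close>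
  then have "t_ideal free_alg (\<Inter>(insert (carr free_alg) ((\<lambda>B. identities_of {B}) ` M)))"
    using t_ideal_carr_free by (intro t_ideal_Inter) auto
  moreover have "identities_of M = \<Inter>(insert (carr free_alg) ((\<lambda>B. identities_of {B}) ` M))"
    by (auto simp: identities_of_def)
  ultimately show ?thesis by (simp only: free_t_ideal_def)
qed

text \<open>A nonzero homogeneous element has a unique degree, and the zero element has no nonzero
  consequences; so the degree in the definition of \<^const>\<open>higher_consequences\<close> may be fixed.\<close>

lemma higher_consequences_cls:
  fixes M :: "('k::field_char_0, 'b) alg set"
  assumes "free_t_ideal (identities_of M)" and f: "f \<in> carr free_alg" "hom_part n f = f"
  shows "higher_consequences M (cls M f)
    = cls M ` {p \<in> t_ideal_gen free_alg (insert f (identities_of M)).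
        part (\<lambda>w. length w \<le> n) p \<in> identities_of M}"
proof -
  let ?T = "identities_of M"
  interpret T: free_t_ideal ?T by fact
  let ?G = "t_ideal_gen free_alg (insert f ?T)"
  have cls: "cls M = coset free_alg ?T" by (simp add: cls_def fun_eq_iff)
  \<comment> \<open>\<open>component\<close> is a union over a whole coset; it collapses because
    \<open>?T\<close> contains the homogeneous components of its elements.\<close>
  have component: "component M d (cls M p) = cls M (hom_part d p)" for d p
    unfolding component_def cls
  proof (rule T.UN_coset_eq)
    fix x assume "x \<in> coset free_alg ?T p"
    then show "coset free_alg ?T (hom_part d x) = coset free_alg ?T (hom_part d p)"
      using T.hom_part[of "x - p" d] by (simp add: T.mem_coset T.coset_eq_iff hom_part_eq part_minus)
  qed
  have zer: "zer (rel_free M) = cls M 0" by (simp add: rel_free_def T.quot_zer cls)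
  have component_zer: "component M d (cls M p) = zer (rel_free M) \<longleftrightarrow> hom_part d p \<in> ?T" for d p
    unfolding component zer by (simp add: cls T.coset_eq_iff)
  have gen: "t_ideal_gen (rel_free M) {cls M f} = cls M ` ?G"
    unfolding rel_free_def cls by (rule T.t_ideal_gen_quot) (rule f)
  have homogeneous: "homogeneous M m (cls M f) \<longleftrightarrow> hom_part m f - f \<in> ?T" for m
    using imageI[OF f(1), of "coset free_alg ?T"]
    by (simp add: homogeneous_def component[unfolded cls] cls T.coset_eq_iff rel_free_def T.quot_carr)
  have part_iff: "part (\<lambda>w. length w \<le> n) p \<in> ?T \<longleftrightarrow> (\<forall>d\<le>n. hom_part d p \<in> ?T)" for p
  proof
    assume *: "part (\<lambda>w. length w \<le> n) p \<in> ?T"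
    show "\<forall>d\<le>n. hom_part d p \<in> ?T"
    proof (intro allI impI)
      fix d assume "d \<le> n"
      then have "hom_part d (part (\<lambda>w. length w \<le> n) p) = hom_part d p"
        unfolding hom_part_eq part_part by (intro arg_cong[of _ _ "\<lambda>Q. part Q p"]) auto
      then show "hom_part d p \<in> ?T" using T.hom_part[OF *, of d] by simp
    qed
  qed (auto simp: part_le_eq_sum intro: T.sum)
  have "(\<exists>m. homogeneous M m (cls M f) \<and> (\<forall>d. component M d (cls M p) \<noteq> zer (rel_free M) \<longrightarrow> m < d))
      \<longleftrightarrow> part (\<lambda>w. length w \<le> n) p \<in> ?T" if p: "p \<in> ?G" for p
    unfolding component_zer homogeneous part_iff
  proof
    assume "\<forall>d\<le>n. hom_part d p \<in> ?T"
    then show "\<exists>m. hom_part m f - f \<in> ?T \<and> (\<forall>d. hom_part d p \<notin> ?T \<longrightarrow> m < d)"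
      using f(2) by (intro exI[of _ n]) (auto simp: not_le[symmetric])
  next
    assume "\<exists>m. hom_part m f - f \<in> ?T \<and> (\<forall>d. hom_part d p \<notin> ?T \<longrightarrow> m < d)"
    then obtain m where m: "hom_part m f - f \<in> ?T" "\<And>d. hom_part d p \<notin> ?T \<Longrightarrow> m < d" by blast
    show "\<forall>d\<le>n. hom_part d p \<in> ?T"
    proof (cases "m = n")
      case False
      have "hom_part m (hom_part n f) = 0"
        unfolding hom_part_eq part_part using False by (auto intro!: poly_mapping_eqI simp: lookup_part)
      then have "f \<in> ?T" using m(1) f(2) T.uminus[of "- f"] by simp
      then have "?G \<subseteq> ?T" by (intro t_ideal_gen_least T.I) auto
      then show ?thesis using p T.hom_part by blast
    qed (use m(2) in \<open>meson leD\<close>)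
  qed
  then show ?thesis unfolding higher_consequences_def gen by blast
qed

text \<open>As \<open>g\<close> is homogeneous of degree above \<open>n\<close>,
  \<open>t_ideal_high\<close> places all its consequences among the higher consequences of
  \<open>f\<close>. The converse inclusion is the assumption \<open>high\<close>.\<close>

lemma higher_consequences_eqI:
  fixes M :: "('k::field_char_0, 'b) alg set"
  defines "T \<equiv> identities_of M"
  assumes T: "free_t_ideal T"
    and f: "f \<in> carr free_alg" "hom_part n f = f"
    and g: "g \<in> t_ideal_gen free_alg (insert f T)" "hom_part m g = g" "n < m"
    and high: "\<And>p. p \<in> t_ideal_gen free_alg (insert f T) \<Longrightarrow> part (\<lambda>w. length w \<le> n) p \<in> T
      \<Longrightarrow> p \<in> t_ideal_gen free_alg (insert g T)"
  shows "higher_consequences M (cls M f) = t_ideal_gen (rel_free M) {cls M g}"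
proof -
  interpret T: free_t_ideal T by fact
  interpret G: free_t_ideal "t_ideal_gen free_alg (insert f T)"
    by (rule free_t_ideal_gen) (use f T.carr in auto)
  have cls: "cls M = coset free_alg T" by (simp add: cls_def fun_eq_iff T_def)
  have gA: "g \<in> carr free_alg" using g(1) by (rule G.carr)
  have "part (\<lambda>w. length w \<le> n) (hom_part m g) = 0"
    unfolding hom_part_eq part_part using g(3) by (auto intro!: poly_mapping_eqI simp: lookup_part)
  then have "t_ideal_gen free_alg (insert g T) \<subseteq> {p \<in> carr free_alg. part (\<lambda>w. length w \<le> n) p \<in> T}"
    using g(2) gA T.carr T.part_le by (intro t_ideal_gen_least T.t_ideal_high) auto
  moreover have "t_ideal_gen free_alg (insert g T) \<subseteq> t_ideal_gen free_alg (insert f T)"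
    using g(1) t_ideal_gen_superset[of "insert f T" free_alg] by (intro t_ideal_gen_least G.I) auto
  ultimately have "{p \<in> t_ideal_gen free_alg (insert f T). part (\<lambda>w. length w \<le> n) p \<in> T}
      = t_ideal_gen free_alg (insert g T)"
    using high by blast
  moreover have "t_ideal_gen (rel_free M) {cls M g} = cls M ` t_ideal_gen free_alg (insert g T)"
    unfolding rel_free_def cls T_def[symmetric] by (rule T.t_ideal_gen_quot) (rule gA)
  ultimately show ?thesis
    using higher_consequences_cls[OF T[unfolded T_def] f] unfolding T_def by simp
qed

section \<open>Consequences of \<open>[x\<^sup>2, y] = 0\<close>\<close>

text \<open>With numeral multiples written as repeated sums, \<open>algebra_simps\<close> verifies a
  noncommutative identity by cancelling monomials.\<close>

lemma numeral_mult_expand: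
  "2 * p = p + p" "3 * p = p + p + p" "4 * p = p + p + p + p" for p :: "'a::semiring_1"
  using distrib_right[of 2 1 p] distrib_right[of 2 2 p] by (simp_all add: mult_2 add.assoc)

text \<open>Instances are \<open>T\<close> itself and every
  \<open>t_ideal_gen free_alg (insert f T)\<close>, so the identities below also hold modulo the
  consequences of an additional \<open>f\<close>.\<close>

locale sq_central_ideal = free_t_ideal +
  assumes sq_central: "a \<in> carr free_alg \<Longrightarrow> b \<in> carr free_alg \<Longrightarrow> comm (a ^ 2) b \<in> I"
begin

lemma anticomm_central:
  assumes "a \<in> carr free_alg" "b \<in> carr free_alg" "c \<in> carr free_alg"
  shows "comm (a * b + b * a) c \<in> I"
proof -
  have "comm (a * b + b * a) c = comm ((a + b) ^ 2) c - comm (a ^ 2) c - comm (b ^ 2) c"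
    by (simp add: comm_def power2_eq_square algebra_simps numeral_mult_expand)
  also have "\<dots> \<in> I" using assms by (intro diff sq_central) auto
  finally show ?thesis .
qed

lemma anticomm_mult_comm:
  assumes "a \<in> carr free_alg" "b \<in> carr free_alg" "c \<in> carr free_alg" "d \<in> carr free_alg"
  shows "(a * b + b * a) * comm c d \<in> I" "comm c d * (a * b + b * a) \<in> I"
proof -
  define h where "h = a * b + b * a"
  have h: "h \<in> carr free_alg" using assms by (simp add: h_def)
  have c: "comm h x \<in> I" if "x \<in> carr free_alg" for x
    unfolding h_def using assms that by (intro anticomm_central)
  \<comment> \<open>Since \<open>h\<close> is central modulo \<open>I\<close>,
    \<open>h * c + c * h\<close> agrees with \<open>2 * h * c\<close>. Being an anticommutator, it
    is central too, and its commutator with \<open>d\<close> is \<open>2 * h * comm c d\<close> up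
    to terms containing \<open>comm h c\<close> or \<open>comm h d\<close>.\<close>
  have "2 * (h * comm c d) = comm (h * c + c * h) d + comm h c * d - d * comm h c - 2 * (comm h d * c)"
    by (simp add: comm_def algebra_simps numeral_mult_expand)
  also have "\<dots> \<in> I"
    using assms h
    by (intro add diff numeral; (intro anticomm_central mult_left[OF c] mult_right[OF c] c)?; simp)
  finally show *: "(a * b + b * a) * comm c d \<in> I" unfolding h_def[symmetric] by (rule numeral_cancel)
  have "comm c d * h = h * comm c d - comm h (comm c d)" by (simp add: comm_def algebra_simps numeral_mult_expand)
  also have "\<dots> \<in> I" using * assms c by (intro diff) (auto simp: h_def)
  finally show "comm c d * (a * b + b * a) \<in> I" by (simp add: h_def)
qed

text \<open>The explicit linear combinations below consist of multiples of terms of these shapes, so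
  membership can be checked summand by summand.\<close>

lemmas central_rules = anticomm_central
  mult_left[OF anticomm_central] mult_right[OF anticomm_central]
  anticomm_mult_comm
  mult_left[OF anticomm_mult_comm(1)] mult_right[OF anticomm_mult_comm(1)]
  mult_left[OF anticomm_mult_comm(2)] mult_right[OF anticomm_mult_comm(2)]

section \<open>Symmetries of \<open>comm a b * c * d\<close> modulo the ideal\<close>

lemma comm_skew_right:
  assumes "a \<in> carr free_alg" "b \<in> carr free_alg" "c \<in> carr free_alg" "d \<in> carr free_alg"
  shows "comm a b * c * d + comm a b * d * c \<in> I"
  using anticomm_mult_comm(2)[of c d a b] assms by (simp add: algebra_simps numeral_mult_expand)

text \<open>The integer coefficients in the next proofs solve the linear system for the
  24 multilinear words of degree 4.\<close>

lemma comm_pair_sym: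
  assumes "a \<in> carr free_alg" "b \<in> carr free_alg" "c \<in> carr free_alg" "d \<in> carr free_alg"
  shows "comm a b * c * d - comm c d * a * b \<in> I"
proof (rule numeral_cancel)
  have "2 * (comm a b * c * d - comm c d * a * b) =
      (c * d + d * c) * comm a b - comm c d * (a * b + b * a)
      + 2 * comm (a * c * d + d * (a * c)) b + 2 * comm (d * a * b + b * (d * a)) c
      + 2 * comm (d * b * c + c * (d * b)) a - 2 * comm (b * c * d + d * (b * c)) a
      + 2 * (d * comm (b * c + c * b) a) + 2 * (comm (b * c + c * b) d * a)"
    by (simp add: comm_def algebra_simps numeral_mult_expand)
  also have "\<dots> \<in> I"
    using assms by (intro add diff numeral; (intro central_rules)?; simp)
  finally show "2 * (comm a b * c * d - comm c d * a * b) \<in> I" .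
qed

lemma comm_cyclic:
  assumes "a \<in> carr free_alg" "b \<in> carr free_alg" "c \<in> carr free_alg" "d \<in> carr free_alg"
  shows "comm a b * c * d + comm b c * a * d + comm c a * b * d \<in> I"
proof (rule numeral_cancel)
  have "2 * (comm a b * c * d + comm b c * a * d + comm c a * b * d) =
      comm (b * c + c * b) a * d + 2 * (comm (a * c + c * a) b * d)
      - 3 * comm (c * d * b + b * (c * d)) a + 3 * (c * comm (b * d + d * b) a)
      - 3 * (comm a c * (b * d + d * b)) + 3 * (comm b c * (a * d + d * a))"
    by (simp add: comm_def algebra_simps numeral_mult_expand)
  also have "\<dots> \<in> I"
    using assms by (intro add diff numeral; (intro central_rules)?; simp)
  finally show "2 * (comm a b * c * d + comm b c * a * d + comm c a * b * d) \<in> I" .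
qed

section \<open>Commutators accompanied by three further factors\<close>

text \<open>Next to \<open>comm x y\<close> an anticommutator vanishes, so exchanging factors
  changes the sign. Moving \<open>c\<close> past the product \<open>a * b\<close> costs one sign,
  moving it past \<open>b\<close> and then past \<open>a\<close> costs two; hence twice the product
  lies in \<open>I\<close>.\<close>

lemma mult3_comm:
  assumes A: "a \<in> carr free_alg" "b \<in> carr free_alg" "c \<in> carr free_alg"
    "x \<in> carr free_alg" "y \<in> carr free_alg"
  shows "a * b * c * comm x y \<in> I" "comm x y * a * b * c \<in> I"
proof -
  have h: "(u * w + w * u) * v * comm x y \<in> I" "comm x y * v * (u * w + w * u) \<in> I"
    if "u \<in> carr free_alg" "v \<in> carr free_alg" "w \<in> carr free_alg" for u v w
  proof -
    have "(u * w + w * u) * v * comm x y = comm (u * w + w * u) v * comm x y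
        + v * ((u * w + w * u) * comm x y)"
      by (simp add: comm_def algebra_simps numeral_mult_expand)
    also have "\<dots> \<in> I"
      using A that by (intro add; (intro central_rules)?; simp)
    finally show "(u * w + w * u) * v * comm x y \<in> I" .
    have "comm x y * v * (u * w + w * u) = comm x y * (u * w + w * u) * v
        - comm x y * comm (u * w + w * u) v"
      by (simp add: comm_def algebra_simps numeral_mult_expand)
    also have "\<dots> \<in> I"
      using A that by (intro diff; (intro central_rules)?; simp)
    finally show "comm x y * v * (u * w + w * u) \<in> I" .
  qed
  have "2 * (a * b * c * comm x y) = (a * b * c + c * (a * b)) * comm x y
      + a * ((b * c + c * b) * comm x y) - (a * c + c * a) * b * comm x y"
    by (simp add: algebra_simps numeral_mult_expand)
  also have "\<dots> \<in> I"
    using A by (intro add diff; (intro central_rules h)?; simp)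
  finally show "a * b * c * comm x y \<in> I" by (rule numeral_cancel)
  have "2 * (comm x y * a * b * c) = comm x y * (a * (b * c) + b * c * a)
      + comm x y * (a * b + b * a) * c - comm x y * b * (a * c + c * a)"
    by (simp add: algebra_simps numeral_mult_expand)
  also have "\<dots> \<in> I"
    using A by (intro add diff; (intro central_rules h)?; simp)
  finally show "comm x y * a * b * c \<in> I" by (rule numeral_cancel)
qed

text \<open>Split \<open>2 * (a * b)\<close> into anticommutator and commutator. In
  \<open>comm a b * comm x y * c\<close>, replacing \<open>comm x y\<close> by
  \<open>2 * (x * y)\<close> minus an anticommutator leaves \<open>comm a b * x * y * c\<close>,
  which \<open>mult3_comm\<close> covers; the other side is symmetric.\<close>

lemma mult2_comm_mult:
  assumes A: "a \<in> carr free_alg" "b \<in> carr free_alg" "c \<in> carr free_alg"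
    "x \<in> carr free_alg" "y \<in> carr free_alg"
  shows "a * b * comm x y * c \<in> I" "c * comm x y * a * b \<in> I"
proof -
  have "2 * (a * b * comm x y * c) = (a * b + b * a) * comm x y * c
      + (2 * (comm a b * x * y * c) - comm a b * (x * y + y * x) * c)"
    by (simp add: comm_def algebra_simps numeral_mult_expand)
  also have "\<dots> \<in> I"
    using A by (intro add diff numeral; (intro central_rules mult3_comm)?; simp)
  finally show "a * b * comm x y * c \<in> I" by (rule numeral_cancel)
  have "2 * (c * comm x y * a * b) = c * (comm x y * (a * b + b * a))
      + (2 * (c * x * y * comm a b) - c * ((x * y + y * x) * comm a b))"
    by (simp add: comm_def algebra_simps numeral_mult_expand)
  also have "\<dots> \<in> I"
    using A by (intro add diff numeral; (intro central_rules mult3_comm)?; simp)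
  finally show "c * comm x y * a * b \<in> I" by (rule numeral_cancel)
qed

text \<open>Polarisation, as in the proof that sectional curvature determines the curvature tensor:
  \<open>q\<close> kills \<open>E x y x y\<close>, linearising in \<open>x\<close> and then in
  \<open>y\<close> yields a new skew symmetry, and the cyclic identity finishes.\<close>

lemma comm_degree4:
  assumes q: "\<And>x y. x \<in> carr free_alg \<Longrightarrow> y \<in> carr free_alg \<Longrightarrow> x * comm x y * y \<in> I"
    and A: "a \<in> carr free_alg" "b \<in> carr free_alg" "c \<in> carr free_alg" "d \<in> carr free_alg"
  shows "comm a b * c * d \<in> I" "a * b * comm c d \<in> I" "a * comm b c * d \<in> I"
proof -
  define E where "E = (\<lambda>a b c d :: 'a nc_poly. comm a b * c * d)"
  have xyxy: "E x y x y \<in> I" if "x \<in> carr free_alg" "y \<in> carr free_alg" for x y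
  proof -
    have "E x y x y = comm (x ^ 2) y * y - x * comm x y * y"
      by (simp add: E_def comm_def power2_eq_square algebra_simps numeral_mult_expand)
    also have "\<dots> \<in> I" using that by (intro diff; (intro sq_central mult_left[OF sq_central] mult_right[OF sq_central] q)?; simp)
    finally show ?thesis .
  qed
  have xyzy: "E x y z y \<in> I" if "x \<in> carr free_alg" "y \<in> carr free_alg" "z \<in> carr free_alg" for x y z
  proof (rule numeral_cancel)
    have "2 * E x y z y = E (x + z) y (x + z) y - E x y x y - E z y z y
        + (comm x y * z * y - comm z y * x * y)"
      by (simp add: E_def comm_def algebra_simps numeral_mult_expand)
    also have "\<dots> \<in> I" using that by - (rule xyxy comm_pair_sym add diff; (simp; fail)?)+
    finally show "2 * E x y z y \<in> I" .
  qed
  have skew: "E x y z t + E x t z y \<in> I"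
    if "x \<in> carr free_alg" "y \<in> carr free_alg" "z \<in> carr free_alg" "t \<in> carr free_alg" for x y z t
  proof -
    have "E x y z t + E x t z y = E x (y + t) z (y + t) - E x y z y - E x t z t"
      by (simp add: E_def comm_def algebra_simps numeral_mult_expand)
    also have "\<dots> \<in> I" using that by (intro diff; (intro xyzy)?; simp)
    finally show ?thesis .
  qed
  have E: "E a b c d \<in> I"
    if "a \<in> carr free_alg" "b \<in> carr free_alg" "c \<in> carr free_alg" "d \<in> carr free_alg" for a b c d
  proof (rule numeral_cancel)
    \<comment> \<open>\<open>E\<close> now changes sign under exchange of the arguments 1-2, 3-4 and
      2-4, hence under every transposition, so the three terms of the cyclic sum coincide modulo
      \<open>I\<close>.\<close>
    have "3 * E a b c d = (comm a b * c * d + comm b c * a * d + comm c a * b * d)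
        + (comm c b * a * d - comm a d * c * b) + (E a d c b + E a b c d)
        + (comm a c * b * d + comm a c * d * b) - (E a c d b + E a b d c)
        + (comm a b * d * c + comm a b * c * d)"
      by (simp add: E_def comm_def algebra_simps numeral_mult_expand)
    also have "\<dots> \<in> I"
      using that by - (rule comm_cyclic comm_pair_sym skew comm_skew_right add diff; (simp; fail)?)+
    finally show "3 * E a b c d \<in> I" .
  qed
  then show "comm a b * c * d \<in> I" using A by (simp add: E_def)
  have F: "a * b * comm c d \<in> I"
    if "a \<in> carr free_alg" "b \<in> carr free_alg" "c \<in> carr free_alg" "d \<in> carr free_alg" for a b c d
  proof (rule numeral_cancel)
    have "2 * (a * b * comm c d) = E a b c d - E a b d c + (a * b + b * a) * comm c d"
      by (simp add: E_def comm_def algebra_simps numeral_mult_expand)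
    also have "\<dots> \<in> I" using that by (intro add diff; (intro E central_rules)?; simp)
    finally show "2 * (a * b * comm c d) \<in> I" .
  qed
  then show "a * b * comm c d \<in> I" using A by simp
  show "a * comm b c * d \<in> I"
  proof (rule numeral_cancel)
    have "2 * (a * comm b c * d) = 2 * (a * b * comm c d) - 2 * E a c b d
        + comm (b * d * a + a * (b * d)) c - comm (d * a * b + b * (d * a)) c
        + comm (a * b * d + d * (a * b)) c"
      by (simp add: E_def comm_def algebra_simps numeral_mult_expand)
    also have "\<dots> \<in> I" using A by (intro add diff numeral; (intro E F central_rules)?; simp)
    finally show "2 * (a * comm b c * d) \<in> I" .
  qed
qed

section \<open>Consequences of \<open>[x, y] x\<close>, of \<open>S\<^sub>3\<close> and of nil
  identities\<close>

text \<open>Because \<open>comm (x ^ 2) y = x * comm x y + comm x y * x\<close>, moving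
  \<open>x\<close> across \<open>comm x y\<close> only changes the sign modulo
  \<open>I\<close>.\<close>

lemma mult_comm_mult_of_comm_mult:
  assumes "\<And>x y. x \<in> carr free_alg \<Longrightarrow> y \<in> carr free_alg \<Longrightarrow> comm x y * x \<in> I"
    and A: "x \<in> carr free_alg" "y \<in> carr free_alg"
  shows "x * comm x y * y \<in> I"
proof -
  have "x * comm x y * y = comm (x ^ 2) y * y - comm x y * x * y"
    by (simp add: comm_def power2_eq_square algebra_simps numeral_mult_expand)
  also have "\<dots> \<in> I" using A by (intro diff; (intro sq_central mult_left[OF sq_central] mult_right[OF sq_central] assms(1) mult_left[OF assms(1)] mult_right[OF assms(1)])?; simp)
  finally show ?thesis .
qed

lemma mult_comm_mult_of_standard3:
  assumes S: "\<And>x y z. x \<in> carr free_alg \<Longrightarrow> y \<in> carr free_alg \<Longrightarrow> z \<in> carr free_alg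
      \<Longrightarrow> comm x y * z + comm y z * x + comm z x * y \<in> I"
    and A: "x \<in> carr free_alg" "y \<in> carr free_alg"
  shows "x * comm x y * y \<in> I"
proof (rule numeral_cancel)
  \<comment> \<open>The standard polynomial is evaluated at \<open>x * y, x, y\<close>, with value
    \<open>comm x y ^ 2 - x * comm x y * y\<close>. The other terms say that
    \<open>comm x y ^ 2\<close> agrees with \<open>- 2 * (x * comm x y * y)\<close> modulo
    \<open>I\<close>.\<close>
  have "3 * (x * comm x y * y) = - (comm (x * y) x * y + comm x y * (x * y) + comm y (x * y) * x)
      - 2 * (x * comm (y ^ 2) x) - (x * y + y * x) * comm x y"
    by (simp add: comm_def power2_eq_square algebra_simps numeral_mult_expand)
  also have "\<dots> \<in> I"
    using A by (intro diff uminus numeral; (intro S sq_central mult_left[OF sq_central] mult_right[OF sq_central] central_rules)?; simp)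
  finally show "3 * (x * comm x y * y) \<in> I" .
qed

text \<open>All products anticommute, including those with composite factors, so the sign conflict
  of \<open>mult3_comm\<close> already occurs for \<open>a * b * c\<close>.\<close>

lemma nil2_mult3:
  assumes n: "\<And>x. x \<in> carr free_alg \<Longrightarrow> x ^ 2 \<in> I"
    and A: "a \<in> carr free_alg" "b \<in> carr free_alg" "c \<in> carr free_alg"
  shows "a * b * c \<in> I"
proof (rule numeral_cancel)
  have anti: "x * y + y * x \<in> I" if "x \<in> carr free_alg" "y \<in> carr free_alg" for x y
  proof -
    have "x * y + y * x = (x + y) ^ 2 - x ^ 2 - y ^ 2"
      by (simp add: power2_eq_square algebra_simps numeral_mult_expand)
    also have "\<dots> \<in> I" using that by (intro diff; (intro n)?; simp)
    finally show ?thesis .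
  qed
  have "2 * (a * b * c) = (a * b * c + c * (a * b)) + a * (b * c + c * b) - (a * c + c * a) * b"
    by (simp add: algebra_simps numeral_mult_expand)
  also have "\<dots> \<in> I" using A by - (rule anti mult_left[OF anti] mult_right[OF anti] add diff; (simp; fail)?)+
  finally show "2 * (a * b * c) \<in> I" .
qed

text \<open>Let \<open>h\<close> be an anticommutator, central modulo \<open>I\<close>. The
  linearised cube at \<open>h, z, t\<close> reduces to \<open>3 * (h * (z * t + t * z))\<close>;
  together with \<open>h * comm z t\<close> this puts \<open>h * z * t\<close> into
  \<open>I\<close>. Centrality then allows \<open>h\<close> to stand anywhere in a product of degree
  4.\<close>

lemma nil3_mult4:
  assumes n: "\<And>x. x \<in> carr free_alg \<Longrightarrow> x ^ 3 \<in> I"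
    and A: "a \<in> carr free_alg" "b \<in> carr free_alg" "c \<in> carr free_alg" "d \<in> carr free_alg"
  shows "a * b * c * d \<in> I"
proof -
  have lin: "(x * y + y * x) * z + (x * z + z * x) * y + (y * z + z * y) * x \<in> I"
    if "x \<in> carr free_alg" "y \<in> carr free_alg" "z \<in> carr free_alg" for x y z
  proof -
    have "(x * y + y * x) * z + (x * z + z * x) * y + (y * z + z * y) * x =
        (x + y + z) ^ 3 - (x + y) ^ 3 - (x + z) ^ 3 - (y + z) ^ 3 + x ^ 3 + y ^ 3 + z ^ 3"
      by (simp add: power3_eq_cube algebra_simps numeral_mult_expand)
    also have "\<dots> \<in> I" using that by (intro add diff; (intro n)?; simp)
    finally show ?thesis .
  qed
  have anti: "(x * y + y * x) * z * t \<in> I" "z * (x * y + y * x) * t \<in> I" "z * t * (x * y + y * x) \<in> I"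
    if "x \<in> carr free_alg" "y \<in> carr free_alg" "z \<in> carr free_alg" "t \<in> carr free_alg" for x y z t
  proof -
    define h where "h = x * y + y * x"
    have h: "h \<in> carr free_alg" using that by (simp add: h_def)
    have c: "comm h z \<in> I" if "z \<in> carr free_alg" for z
      unfolding h_def using \<open>x \<in> _\<close> \<open>y \<in> _\<close> that by (rule anticomm_central)
    have "3 * (h * (z * t + t * z)) = ((h * z + z * h) * t + (h * t + t * h) * z + (z * t + t * z) * h)
        + comm h z * t + comm h t * z + comm h (z * t + t * z)"
      by (simp add: comm_def algebra_simps numeral_mult_expand)
    also have "\<dots> \<in> I" using that h by - (rule lin c mult_right[OF c] add; (simp; fail)?)+
    finally have s: "h * (z * t + t * z) \<in> I" by (rule numeral_cancel)
    have "2 * (h * z * t) = h * (z * t + t * z) + (x * y + y * x) * comm z t"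
      by (simp add: h_def comm_def algebra_simps numeral_mult_expand)
    also have "\<dots> \<in> I" using that s by (intro add; (intro central_rules)?; simp)
    finally have hzt: "h * z * t \<in> I" by (rule numeral_cancel)
    then show "(x * y + y * x) * z * t \<in> I" by (simp add: h_def)
    have "z * h * t = h * z * t - comm h z * t" by (simp add: comm_def algebra_simps numeral_mult_expand)
    also have "\<dots> \<in> I" using that hzt by (intro diff; (intro c mult_left[OF c] mult_right[OF c])?; simp)
    finally show "z * (x * y + y * x) * t \<in> I" by (simp add: h_def)
    have "z * t * h = h * z * t - comm h (z * t)" by (simp add: comm_def algebra_simps numeral_mult_expand)
    also have "\<dots> \<in> I" using that hzt by (intro diff; (intro c)?; simp)
    finally show "z * t * (x * y + y * x) \<in> I" by (simp add: h_def)
  qed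
  \<comment> \<open>Degree 4 words are now alternating in adjacent letters, and all terms of
    \<open>comm (a * b * c + c * (a * b)) d\<close> then carry the same sign.\<close>
  have "4 * (a * b * c * d) = comm (a * b * c + c * (a * b)) d - (a * c + c * a) * b * d
      + 2 * (a * (b * c + c * b) * d) + (a * d + d * a) * b * c - a * (b * d + d * b) * c
      + a * b * (c * d + d * c) + (c * d + d * c) * a * b - c * (a * d + d * a) * b
      + (a * c + c * a) * d * b - a * c * (b * d + d * b)"
    by (simp add: comm_def algebra_simps numeral_mult_expand)
  also have "\<dots> \<in> I" using A by (intro add diff numeral; (intro anti central_rules)?; simp)
  finally show ?thesis by (rule numeral_cancel)
qed

end

section \<open>Words commuting modulo an ideal\<close>

lemma word_split_last:
  assumes "n \<le> length u"
  obtains x y where "u = x @ y" "length y = n"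
  using assms that[of "take (length u - n) u" "drop (length u - n) u"] by simp

lemma word_split_first:
  assumes "n \<le> length u"
  obtains x y where "u = x @ y" "length x = n"
  using assms that[of "take n u" "drop n u"] by simp

lemma single_append: "single (u @ v) (1 :: 'k::field) = single u 1 * single v 1"
  by (simp add: single_mult_single)

lemma single_Cons: "v \<noteq> [] \<Longrightarrow> single (i # v) (1 :: 'k::field) = X i * single v 1"
  by (simp add: X_def single_mult_single)

context free_t_ideal
begin

lemma mult_word_left: "p \<in> I \<Longrightarrow> single u 1 * p \<in> I"
  by (cases "u = []") (simp_all add: mult_left)

lemma mult_word_right: "p \<in> I \<Longrightarrow> p * single u 1 \<in> I"
  by (cases "u = []") (simp_all add: mult_right)

lemma diff_trans: "p - q \<in> I \<Longrightarrow> q - r \<in> I \<Longrightarrow> p - r \<in> I"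
  using add[of "p - q" "q - r"] by simp

definition words_commute :: "nat \<Rightarrow> bool" where
  "words_commute n \<longleftrightarrow> (\<forall>w w'. n \<le> length w \<longrightarrow> mset w = mset w' \<longrightarrow> single w 1 - single w' 1 \<in> I)"

text \<open>Adjacent exchanges suffice: the tail is rearranged by induction, and the head letter is
  then carried to its place in \<open>w'\<close>. The prefix \<open>u\<close> is general so that the
  induction can pass under a fixed first letter.\<close>

lemma words_commuteI:
  assumes "\<And>u v i j. n \<le> length u + length v + 2 \<Longrightarrow>
    single u 1 * comm (X i) (X j) * single v 1 \<in> I"
  shows "words_commute n"
proof -
  have swap: "single (u @ i # j # v) 1 - single (u @ j # i # v) 1 \<in> I"
    if "n \<le> length (u @ i # j # v)" for u v i j
    using assms[of u v i j] that
    by (simp add: X_def comm_def single_mult_single algebra_simps)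
  have front: "single (u @ a # x @ y) 1 - single (u @ x @ a # y) 1 \<in> I"
    if "n \<le> length (u @ a # x @ y)" for u a x y
    using that
  proof (induction x arbitrary: u)
    case (Cons b x)
    have "single (u @ a # b # (x @ y)) 1 - single (u @ b # a # (x @ y)) 1 \<in> I"
      using Cons.prems by (intro swap) simp
    moreover have "single ((u @ [b]) @ a # x @ y) 1 - single ((u @ [b]) @ x @ a # y) 1 \<in> I"
      using Cons.prems by (intro Cons.IH) simp
    ultimately show ?case using diff_trans by simp
  qed simp
  have "single (u @ w) 1 - single (u @ w') 1 \<in> I"
    if "n \<le> length (u @ w)" "mset w = mset w'" for u w w'
    using that
  proof (induction w arbitrary: u w')
    case (Cons a w)
    then have "a \<in> set w'" by (metis list.set_intros(1) set_mset_mset)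
    then obtain x y where w': "w' = x @ a # y" by (meson split_list)
    then have "single ((u @ [a]) @ w) 1 - single ((u @ [a]) @ x @ y) 1 \<in> I"
      using Cons.prems by (intro Cons.IH) auto
    moreover have "length w = length (x @ y)"
      using Cons.prems(2) w' mset_eq_length by fastforce
    then have "single (u @ a # x @ y) 1 - single (u @ x @ a # y) 1 \<in> I"
      using Cons.prems by (intro front) simp
    ultimately show ?case using diff_trans w' by simp
  qed simp
  from this[of "[]"] show ?thesis by (simp add: words_commute_def)
qed

text \<open>A longer context is cut down to \<open>n\<close> letters nearest to the commutator, the
  left side having priority; the rest is multiplied back.\<close>

lemma words_commute_of_blocks:
  assumes "\<And>u v i j. n = length u + length v \<Longrightarrow> single u 1 * comm (X i) (X j) * single v 1 \<in> I"
  shows "words_commute (n + 2)"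
proof (rule words_commuteI)
  fix u v :: "nat list" and i j assume len: "n + 2 \<le> length u + length v + 2"
  obtain x u' where u: "u = x @ u'" "length u' = min n (length u)"
    using word_split_last[of "min n (length u)" u, OF min.cobounded2] .
  obtain v' y where v: "v = v' @ y" "length v' = n - length u'"
  proof (rule word_split_first)
    show "n - length u' \<le> length v" using len u(2) by simp
  qed (rule that)
  have "single x 1 * (single u' 1 * comm (X i) (X j) * single v' 1) * single y 1 \<in> I"
    using u v by (intro mult_word_left mult_word_right assms) simp
  then show "single u 1 * comm (X i) (X j) * single v 1 \<in> I"
    using u v by (simp add: single_append mult.assoc)
qed

end

context sq_central_ideal
begin

lemma words_commute_5: "words_commute 5"
proof -
  have "words_commute (3 + 2)"
  proof (rule words_commute_of_blocks)
    fix u v :: "nat list" and i j assume "3 = length u + length v"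
    then consider a b c where "u = [a, b, c]" "v = []" | a b c where "u = [a, b]" "v = [c]"
      | a b c where "u = [a]" "v = [b, c]" | a b c where "u = []" "v = [a, b, c]"
      by (cases u; cases "tl u"; cases "tl (tl u)")
        (auto simp: Suc_length_conv length_Suc_conv numeral_3_eq_3 numeral_2_eq_2)
    then show "single u 1 * comm (X i) (X j) * single v 1 \<in> I"
    proof cases
      case 1
      then show ?thesis using mult3_comm(1)[of "X a" "X b" "X c" "X i" "X j"]
        by (simp add: single_Cons mult.assoc flip: X_def)
    next
      case 2
      then show ?thesis using mult2_comm_mult(1)[of "X a" "X b" "X c" "X i" "X j"]
        by (simp add: single_Cons mult.assoc flip: X_def)
    next
      case 3
      then show ?thesis using mult2_comm_mult(2)[of "X b" "X c" "X a" "X i" "X j"]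
        by (simp add: single_Cons mult.assoc flip: X_def)
    next
      case 4
      then show ?thesis using mult3_comm(2)[of "X a" "X b" "X c" "X i" "X j"]
        by (simp add: single_Cons mult.assoc flip: X_def)
    qed
  qed
  then show ?thesis by simp
qed

lemma words_commute_4:
  assumes "\<And>x y. x \<in> carr free_alg \<Longrightarrow> y \<in> carr free_alg \<Longrightarrow> x * comm x y * y \<in> I"
  shows "words_commute 4"
proof -
  note deg4 = comm_degree4[OF assms]
  have "words_commute (2 + 2)"
  proof (rule words_commute_of_blocks)
    fix u v :: "nat list" and i j assume "2 = length u + length v"
    then consider a b where "u = [a, b]" "v = []" | a b where "u = [a]" "v = [b]"
      | a b where "u = []" "v = [a, b]"
      by (cases u; cases "tl u") (auto simp: Suc_length_conv length_Suc_conv numeral_2_eq_2)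
    then show "single u 1 * comm (X i) (X j) * single v 1 \<in> I"
    proof cases
      case 1
      then show ?thesis using deg4(2)[of "X a" "X b" "X i" "X j"]
        by (simp add: single_Cons mult.assoc flip: X_def)
    next
      case 2
      then show ?thesis using deg4(3)[of "X a" "X i" "X j" "X b"]
        by (simp add: single_Cons mult.assoc flip: X_def)
    next
      case 3
      then show ?thesis using deg4(1)[of "X i" "X j" "X a" "X b"]
        by (simp add: single_Cons mult.assoc flip: X_def)
    qed
  qed
  then show ?thesis by simp
qed

end

section \<open>The commutator ideal\<close>

text \<open>The kernel of abelianisation on the nonunital free algebra, given by spanning
  differences of words. As \<open>w\<close> and \<open>w'\<close> have equal length, truncation by
  degree keeps or removes each difference as a whole.\<close>

inductive_set commutator_ideal :: "'k::field nc_poly set" where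
  zero: "0 \<in> commutator_ideal"
| add: "p \<in> commutator_ideal \<Longrightarrow> mset w = mset w' \<Longrightarrow> w \<noteq> []
    \<Longrightarrow> p + (single w c - single w' c) \<in> commutator_ideal"

lemma commutator_ideal_add:
  assumes "q \<in> commutator_ideal" "p \<in> commutator_ideal"
  shows "p + q \<in> commutator_ideal"
  using assms by (induction q rule: commutator_ideal.induct)
    (auto intro: commutator_ideal.add simp flip: add.assoc)

lemma commutator_ideal_single:
  "mset w = mset w' \<Longrightarrow> w \<noteq> [] \<Longrightarrow> single w c - single w' c \<in> commutator_ideal"
  using commutator_ideal.add[OF commutator_ideal.zero] by simp

lemma commutator_ideal_single_mult:
  assumes "p \<in> commutator_ideal"
  shows "single v b * p \<in> commutator_ideal" "p * single v b \<in> commutator_ideal"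
  using assms
proof (induction p rule: commutator_ideal.induct)
  case (add p w w' c)
  { case 1
    then show ?case using add
      by (auto simp: distrib_left right_diff_distrib single_mult_single intro!: commutator_ideal.add) }
  { case 2
    then show ?case using add
      by (auto simp: distrib_right left_diff_distrib single_mult_single intro!: commutator_ideal.add) }
qed (simp_all add: commutator_ideal.zero)

lemma commutator_ideal_mult:
  assumes "p \<in> commutator_ideal"
  shows "r * p \<in> commutator_ideal" "p * r \<in> commutator_ideal"
  by (induction r rule: nc_poly_induct)
    (simp_all add: distrib_left distrib_right commutator_ideal_add commutator_ideal_single_mult assms
      commutator_ideal.zero)

lemma comm_in_commutator_ideal:
  assumes "p \<in> carr free_alg"
  shows "comm p q \<in> commutator_ideal"
  using assms
proof (induction p rule: carr_induct)
  case zero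
  then show ?case by (simp add: comm_def commutator_ideal.zero)
next
  case (add p w c)
  have "comm (single w c) q \<in> commutator_ideal"
  proof (induction q rule: nc_poly_induct)
    case zero
    then show ?case by (simp add: comm_def commutator_ideal.zero)
  next
    case (add q v b)
    have "comm (single w c) (single v b) \<in> commutator_ideal"
      using \<open>w \<noteq> []\<close> commutator_ideal_single[of "w @ v" "v @ w" "c * b"]
      by (simp add: comm_def single_mult_single mult.commute)
    moreover have "comm (single w c) (q + single v b) = comm (single w c) q + comm (single w c) (single v b)"
      by (simp add: comm_def algebra_simps)
    ultimately show ?case using add commutator_ideal_add by metis
  qed
  moreover have "comm (p + single w c) q = comm p q + comm (single w c) q"
    by (simp add: comm_def algebra_simps)
  ultimately show ?case using add commutator_ideal_add by metis
qed

lemma commutator_ideal_prod_list: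
  assumes "\<And>i. s i \<in> carr free_alg" "mset w = mset w'"
  shows "prod_list (map s w) - prod_list (map s w') \<in> commutator_ideal"
  using assms(2)
proof (induction w arbitrary: w')
  case (Cons a w)
  then have "a \<in> set w'" by (metis list.set_intros(1) set_mset_mset)
  then obtain x y where w': "w' = x @ a # y" by (meson split_list)
  then have IH: "prod_list (map s w) - prod_list (map s (x @ y)) \<in> commutator_ideal"
    using Cons.prems by (intro Cons.IH) auto
  \<comment> \<open>Moving \<open>s a\<close> to the front across the factors from \<open>x\<close>
    costs one commutator.\<close>
  have "prod_list (map s (a # w)) - prod_list (map s w')
      = s a * (prod_list (map s w) - prod_list (map s (x @ y)))
        + comm (s a) (prod_list (map s x)) * prod_list (map s y)"
    by (simp add: w' comm_def algebra_simps)
  also have "\<dots> \<in> commutator_ideal"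
    by (intro commutator_ideal_add commutator_ideal_mult IH comm_in_commutator_ideal assms(1))
  finally show ?case .
qed (simp add: commutator_ideal.zero)

lemma commutator_ideal_subst:
  assumes "p \<in> commutator_ideal" "\<And>i. s i \<in> carr free_alg"
  shows "subst s p \<in> commutator_ideal"
  using assms(1)
proof (induction p rule: commutator_ideal.induct)
  case (add p w w' c)
  have "subst s (p + (single w c - single w' c))
      = subst s p + single [] c * (prod_list (map s w) - prod_list (map s w'))"
    by (simp add: subst_add subst_minus subst_single algebra_simps)
  also have "\<dots> \<in> commutator_ideal"
    by (intro commutator_ideal_add commutator_ideal_mult commutator_ideal_prod_list add assms(2))
  finally show ?case .
qed (simp add: commutator_ideal.zero)

lemma commutator_ideal_carr: "p \<in> commutator_ideal \<Longrightarrow> p \<in> carr free_alg"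
proof (induction p rule: commutator_ideal.induct)
  case (add p w w' c)
  then have "w' \<noteq> []" by auto
  then show ?case using add by auto
qed simp

lemma t_ideal_commutator_ideal: "t_ideal free_alg commutator_ideal"
  unfolding t_ideal_def
proof (intro conjI ballI allI)
  fix \<phi> :: "'a nc_poly \<Rightarrow> 'a nc_poly" assume \<phi>: "\<phi> \<in> alg_hom free_alg free_alg"
  show "\<phi> ` commutator_ideal \<subseteq> commutator_ideal"
  proof (rule image_subsetI)
    fix p :: "'a nc_poly" assume p: "p \<in> commutator_ideal"
    have "subst (\<phi> \<circ> X) p \<in> commutator_ideal"
      using p by (rule commutator_ideal_subst) (simp add: alg_hom_closed[OF \<phi>])
    then show "\<phi> p \<in> commutator_ideal"
      using alg_hom_free_eq_subst[OF \<phi> commutator_ideal_carr[OF p]] by simp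
  qed
qed (auto simp: commutator_ideal_add commutator_ideal_mult commutator_ideal.zero commutator_ideal_carr)

text \<open>Applied to \<open>T\<close> and the commutator ideal, this lets a consequence of
  \<open>f\<close> be split into one summand from each.\<close>

lemma t_ideal_plus:
  fixes J K :: "'k::field_char_0 nc_poly set"
  assumes "t_ideal free_alg J" "t_ideal free_alg K"
  shows "t_ideal free_alg {a + b | a b. a \<in> J \<and> b \<in> K}"
proof -
  interpret J: free_t_ideal J using assms(1) by unfold_locales
  interpret K: free_t_ideal K using assms(2) by unfold_locales
  let ?S = "{a + b | a b. a \<in> J \<and> b \<in> K}"
  have S: "p \<in> ?S" if "p = a + b" "a \<in> J" "b \<in> K" for p a b
    using that by blast
  show ?thesis
    unfolding t_ideal_def free_alg_simps
  proof (intro conjI ballI allI)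
    fix \<phi> :: "'k nc_poly \<Rightarrow> 'k nc_poly" assume \<phi>: "\<phi> \<in> alg_hom free_alg free_alg"
    show "\<phi> ` ?S \<subseteq> ?S"
    proof (rule image_subsetI)
      fix p assume "p \<in> ?S"
      then obtain a b where ab: "p = a + b" "a \<in> J" "b \<in> K" by blast
      then have "\<phi> p = \<phi> a + \<phi> b"
        using J.carr[OF ab(2)] K.carr[OF ab(3)] \<phi> by (simp add: alg_hom_def)
      then show "\<phi> p \<in> ?S" using J.hom[OF ab(2) \<phi>] K.hom[OF ab(3) \<phi>] by (rule S)
    qed
  next
    show "0 \<in> ?S" by (rule S[of 0 0 0]) simp_all
  next
    fix p q :: "'k nc_poly" assume "p \<in> ?S" "q \<in> ?S"
    then obtain a b c d where abcd: "p = a + b" "q = c + d" "a \<in> J" "b \<in> K" "c \<in> J" "d \<in> K"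
      by blast
    show "p + q \<in> ?S"
      by (rule S[of _ "a + c" "b + d"]) (simp_all add: abcd J.add K.add)
  next
    fix c and p :: "'k nc_poly" assume "p \<in> ?S"
    then obtain a b where ab: "p = a + b" "a \<in> J" "b \<in> K" by blast
    show "single [] c * p \<in> ?S"
      by (rule S[of _ "single [] c * a" "single [] c * b"]) (simp_all add: ab distrib_left J.scal K.scal)
  next
    fix p q :: "'k nc_poly" assume "p \<in> ?S" and q: "q \<in> carr free_alg"
    then obtain a b where ab: "p = a + b" "a \<in> J" "b \<in> K" by blast
    show "p * q \<in> ?S"
      by (rule S[of _ "a * q" "b * q"]) (simp_all add: ab q distrib_right J.mult_right K.mult_right)
    show "q * p \<in> ?S"
      by (rule S[of _ "q * a" "q * b"]) (simp_all add: ab q distrib_left J.mult_left K.mult_left)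
  next
    show "?S \<subseteq> carr free_alg" using J.carr K.carr by auto
  qed
qed

text \<open>Write \<open>p = t + k\<close> with \<open>t\<close> in \<open>T\<close> and
  \<open>k\<close> in the commutator ideal. The low part of \<open>k\<close> lies in
  \<open>T\<close> because those of \<open>p\<close> and \<open>t\<close> do; its high part is a
  combination of differences of words longer than \<open>n\<close>, each of them in
  \<open>J\<close>.\<close>

lemma high_commutator_in_ideal:
  fixes J T :: "'k::field_char_0 nc_poly set"
  assumes T: "free_t_ideal T" and J: "free_t_ideal J" "T \<subseteq> J" "free_t_ideal.words_commute J (Suc n)"
    and f: "f \<in> commutator_ideal"
    and p: "p \<in> t_ideal_gen free_alg (insert f T)" "part (\<lambda>w. length w \<le> n) p \<in> T"
  shows "p \<in> J"
proof -
  interpret T: free_t_ideal T by fact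
  interpret J: free_t_ideal J by fact
  interpret K: free_t_ideal commutator_ideal using t_ideal_commutator_ideal by unfold_locales
  have "f \<in> {a + b | a b. a \<in> T \<and> b \<in> commutator_ideal}"
    using f by (intro CollectI exI[of _ 0] exI[of _ f]) simp
  moreover have "T \<subseteq> {a + b | a b. a \<in> T \<and> b \<in> commutator_ideal}"
  proof
    fix t assume "t \<in> T"
    then show "t \<in> {a + b | a b. a \<in> T \<and> b \<in> commutator_ideal}"
      by (intro CollectI exI[of _ t] exI[of _ 0]) simp
  qed
  ultimately have "t_ideal_gen free_alg (insert f T) \<subseteq> {a + b | a b. a \<in> T \<and> b \<in> commutator_ideal}"
    by (intro t_ideal_gen_least t_ideal_plus T.I K.I) blast
  then obtain t k where tk: "p = t + k" "t \<in> T" "k \<in> commutator_ideal" using p(1) by blast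
  let ?L = "part (\<lambda>w. length w \<le> n)" and ?H = "part (\<lambda>w. \<not> length w \<le> n)"
  have "?L k = ?L p - ?L t" by (simp add: tk part_add)
  then have L: "?L k \<in> T" using T.diff[OF p(2) T.part_le[OF tk(2)]] by simp
  have H: "?H k \<in> J"
    using tk(3)
  proof (induction k rule: commutator_ideal.induct)
    case (add q w w' c)
    have "?H (single w c - single w' c) \<in> J"
    proof (cases "length w \<le> n")
      case True
      then show ?thesis using mset_eq_length[OF add(2)] by (simp add: part_minus part_single)
    next
      case False
      then have "Suc n \<le> length w" by simp
      then have "single w 1 - single w' 1 \<in> J"
        using J(3) add(2) unfolding J.words_commute_def by blast
      then have "single [] c * (single w 1 - single w' 1) \<in> J" by (rule J.scal)
      then show ?thesis
        using False mset_eq_length[OF add(2)]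
        by (simp add: part_minus part_single right_diff_distrib single_mult_single)
    qed
    then show ?case unfolding part_add using add.IH by (intro J.add)
  qed simp
  have "?L k + ?H k = k"
    by (rule poly_mapping_eqI) (simp add: lookup_part lookup_add)
  then show "p \<in> J"
    using J.add[OF subsetD[OF J(2) tk(2)] J.add[OF subsetD[OF J(2) L] H]] tk(1) by simp
qed

section \<open>Powers\<close>

lemma sum_X_power:
  assumes "finite S"
  shows "(\<Sum>i\<in>S. X i) ^ n = (\<Sum>w | set w \<subseteq> S \<and> length w = n. single w (1 :: 'k::field))"
proof (induction n)
  case 0
  have "{w :: nat list. set w \<subseteq> S \<and> length w = 0} = {[]}" by auto
  then show ?case by simp
next
  case (Suc n)
  let ?W = "\<lambda>n. {w. set w \<subseteq> S \<and> length w = n}"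
  have W: "?W (Suc n) = (\<lambda>(i, w). i # w) ` (S \<times> ?W n)"
    by (auto simp: length_Suc_conv image_iff)
  have "(\<Sum>i\<in>S. X i) ^ Suc n = (\<Sum>i\<in>S. \<Sum>w\<in>?W n. X i * single w (1 :: 'k))"
    by (simp add: Suc sum_product)
  also have "\<dots> = (\<Sum>(i, w)\<in>S \<times> ?W n. single (i # w) 1)"
    unfolding sum.cartesian_product by (simp add: X_def single_mult_single)
  also have "\<dots> = (\<Sum>w\<in>?W (Suc n). single w 1)"
    unfolding W by (subst sum.reindex) (auto simp: inj_on_def case_prod_unfold)
  finally show ?case .
qed

lemma sum_list_indicator: "sum_list (map (\<lambda>j. if j = i then 1 else 0) w) = count_list w i"
  by (induction w) auto

text \<open>For each letter of \<open>S\<close> in turn, \<open>part_weight\<close> is applied to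
  the weight that counts its occurrences.\<close>

lemma (in free_t_ideal) part_multilinear:
  assumes "finite S" "p \<in> I"
  shows "part (\<lambda>w. \<forall>i\<in>S. count_list w i = 1) p \<in> I"
  using assms(1)
proof (induction S rule: finite_induct)
  case empty
  then show ?case using assms(2) by (simp add: part_id)
next
  case (insert i S)
  have "part (\<lambda>w. count_list w i = 1) (part (\<lambda>w. \<forall>i\<in>S. count_list w i = 1) p) \<in> I"
    using part_weight[OF insert.IH, of "\<lambda>j. if j = i then 1 else 0" 1]
    by (simp add: sum_list_indicator)
  then show ?case by (simp add: part_part conj_commute)
qed

text \<open>The multilinear component of \<open>(X 1 + \<dots> + X n) ^ n\<close>, multiplied by \<open>X (n + 1)\<close>, is a sum of
  words which all agree modulo the ideal.\<close>

lemma (in sq_central_ideal) nil_word_large: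
  assumes n: "4 \<le> n" and nil: "\<And>x. x \<in> carr free_alg \<Longrightarrow> x ^ n \<in> I"
  shows "single [1..<n + 2] 1 \<in> I"
proof -
  define W where "W = {w. set w \<subseteq> {1..n} \<and> length w = n \<and> (\<forall>i\<in>{1..n}. count_list w i = 1)}"
  have upt: "count_list [1..<n + 1] i = (if i \<in> {1..n} then 1 else 0)" for i
  proof -
    have "distinct [1..<n + 1]" by simp
    then have "count (mset [1..<n + 1]) i = (if i \<in> set [1..<n + 1] then 1 else 0)"
      unfolding distinct_count_atmost_1 by blast
    then show ?thesis unfolding count_mset by auto
  qed
  let ?Q = "\<lambda>w. \<forall>i\<in>{1..n}. count_list w i = 1"
  have fin: "finite {w. set w \<subseteq> {1..n} \<and> length w = n}" by (rule finite_lists_length_eq) simp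
  have finW: "finite W" unfolding W_def by (rule finite_subset[OF _ fin]) auto
  have "(\<Sum>i\<in>{1..n}. X i) \<in> carr free_alg"
    by (simp add: carr_free_alg lookup_sum X_def lookup_single)
  then have "part ?Q ((\<Sum>i\<in>{1..n}. X i) ^ n) \<in> I"
    by (intro part_multilinear nil) auto
  also have "part ?Q ((\<Sum>i\<in>{1..n}. X i) ^ n) = (\<Sum>w\<in>W. single w 1)"
    unfolding sum_X_power[OF finite_atLeastAtMost] part_sum part_single W_def
    using fin by (subst sum.inter_filter[symmetric]) (auto intro!: sum.cong)
  finally have "(\<Sum>w\<in>W. single w 1) * X (n + 1) \<in> I" by (intro mult_right) auto
  then have 1: "(\<Sum>w\<in>W. single (w @ [n + 1]) 1) \<in> I"
    by (simp add: sum_distrib_right X_def single_mult_single)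
  have "single (w @ [n + 1]) 1 - single [1..<n + 2] 1 \<in> I" if "w \<in> W" for w
  proof -
    have "count_list w i = (if i \<in> {1..n} then 1 else 0)" for i
      using that by (auto simp: W_def count_list_0_iff)
    then have "count (mset w) i = count (mset [1..<n + 1]) i" for i
      by (simp only: upt count_mset)
    then have "mset w = mset [1..<n + 1]" by (rule multiset_eqI)
    then have "mset (w @ [n + 1]) = mset [1..<n + 2]" by simp
    then show ?thesis
      using words_commute_5 n that unfolding words_commute_def W_def by simp
  qed
  then have "(\<Sum>w\<in>W. single (w @ [n + 1]) 1 - single [1..<n + 2] 1) \<in> I" by (rule sum)
  then have "(\<Sum>w\<in>W. single (w @ [n + 1]) 1) - of_nat (card W) * single [1..<n + 2] 1 \<in> I"
    by (simp add: sum_subtractf)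
  then have "of_nat (card W) * single [1..<n + 2] 1 \<in> I"
    using diff[OF 1] by fastforce
  then have "single [] (of_nat (card W)) * single [1..<n + 2] 1 \<in> I"
    by (simp flip: zero_list_def)
  \<comment> \<open>The common word occurs \<open>card W\<close> times, a number that is invertible
    in characteristic 0 once \<open>W\<close> is nonempty.\<close>
  moreover have "card W \<noteq> 0"
  proof -
    have "[1..<n + 1] \<in> W"
      unfolding W_def mem_Collect_eq upt
      by (simp add: atLeastLessThanSuc_atLeastAtMost del: upt_Suc)
    then show ?thesis using finW by auto
  qed
  ultimately show ?thesis using scal_cancel by simp
qed

lemma (in sq_central_ideal) nil_word:
  assumes n: "1 \<le> n" and nil: "\<And>x. x \<in> carr free_alg \<Longrightarrow> x ^ n \<in> I"
  shows "single [1..<n + 2] 1 \<in> I"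
proof -
  consider "n = 1" | "n = 2" | "n = 3" | "4 \<le> n" using n by linarith
  then show ?thesis
  proof cases
    case 1
    then show ?thesis using nil[of "single [1..<n + 2] 1"] by simp
  next
    case 2
    then show ?thesis using nil2_mult3[of "X 1" "X 2" "X 3"] nil
      by (simp add: upt_rec single_mult_single X_def eval_nat_numeral)
  next
    case 3
    then show ?thesis using nil3_mult4[of "X 1" "X 2" "X 3" "X 4"] nil
      by (simp add: upt_rec single_mult_single X_def eval_nat_numeral)
  qed (rule nil_word_large[OF _ nil])
qed

text \<open>Every word longer than \<open>n\<close> begins with a substitution instance of the given
  one.\<close>

lemma (in free_t_ideal) long_words:
  assumes g: "single [1..<n + 2] 1 \<in> I" and p: "p \<in> carr free_alg" "part (\<lambda>w. length w \<le> n) p \<in> I"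
  shows "p \<in> I"
proof -
  have "single w c \<in> I" if w: "n < length w" for w c
  proof -
    obtain u v where uv: "w = u @ v" "length u = n + 1"
      using word_split_first[of "n + 1" w] w by auto
    \<comment> \<open>Variables are numbered from 1 and list positions from 0, hence the
      shift.\<close>
    have "subst (\<lambda>i. X (u ! (i - 1))) (single [1..<n + 2] 1) \<in> I"
      using g by (rule subst) auto
    also have "subst (\<lambda>i. X (u ! (i - 1))) (single [1..<n + 2] 1) = prod_list (map X (map (\<lambda>i. u ! (i - 1)) [1..<n + 2]))"
      by (simp add: subst_single comp_def)
    also have "map (\<lambda>i. u ! (i - 1)) [1..<n + 2] = u"
      using uv(2) by (intro nth_equalityI) (simp_all del: upt_Suc)
    also have "prod_list (map X u) = single u 1"
      by (simp add: single_eq_prod[of u])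
    finally have "single [] c * (single u 1 * single v 1) \<in> I" by (intro scal mult_word_right)
    then show ?thesis by (simp add: uv single_mult_single)
  qed
  then have "part (\<lambda>w. \<not> length w \<le> n) p \<in> I"
    unfolding part_def by (intro sum) auto
  then have "part (\<lambda>w. length w \<le> n) p + part (\<lambda>w. \<not> length w \<le> n) p \<in> I"
    using p by (intro add)
  moreover have "part (\<lambda>w. length w \<le> n) p + part (\<lambda>w. \<not> length w \<le> n) p = p"
    by (rule poly_mapping_eqI) (simp add: lookup_part lookup_add)
  ultimately show ?thesis by simp
qed

section \<open>The variety\<close>

lemma standard_poly_3: "standard_poly 3 = comm (X 1) (X 2) * X 3 + comm (X 2) (X 3) * X 1 + comm (X 3) (X 1) * X 2"
proof -
  have S: "{1..3} = insert 1 (insert 2 {3 :: nat})" by auto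
  have f: "finite {2::nat, 3}" "1 \<notin> {2::nat, 3}" "finite {3::nat}" "2 \<notin> {3::nat}" by auto
  show ?thesis
    unfolding standard_poly_def S sum_over_permutations_insert[OF f(1,2)]
      sum_over_permutations_insert[OF f(3,4)] permutes_sing
    by (simp add: sign_swap_id permutation_swap_id sign_compose sign_id upt_rec comm_def algebra_simps transpose_def eval_nat_numeral)
qed

lemma sq_central_ideal_identities:
  "sq_central_ideal (identities_of (sq_central :: ('k::field_char_0, 'k nc_poly set) alg set))"
proof -
  let ?T = "identities_of (sq_central :: ('k, 'k nc_poly set) alg set)"
  interpret T: free_t_ideal ?T
    by (rule free_t_ideal_identities_of) (simp add: sq_central_def variety_def)
  show ?thesis
  proof unfold_locales
    fix a b :: "'k nc_poly" assume ab: "a \<in> carr free_alg" "b \<in> carr free_alg"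
    have "comm (X 1 ^ 2) (X 2) \<in> ?T"
      by (auto simp: identities_of_def sq_central_def variety_def power2_eq_square)
    then have "subst (\<lambda>i. if i = 1 then a else b) (comm (X 1 ^ 2) (X 2)) \<in> ?T"
      by (rule T.subst) (simp add: ab)
    then show "comm (a ^ 2) b \<in> ?T"
      by (simp add: subst_comm subst_mult power2_eq_square)
  qed
qed

lemma sq_central_ideal_gen:
  assumes "sq_central_ideal T" "f \<in> carr free_alg"
  shows "sq_central_ideal (t_ideal_gen free_alg (insert f T))"
proof -
  interpret T: sq_central_ideal T by fact
  interpret G: free_t_ideal "t_ideal_gen free_alg (insert f T)"
    using assms(2) T.carr by (intro free_t_ideal_gen) blast
  show ?thesis
    by unfold_locales
      (use T.sq_central t_ideal_gen_superset[of "insert f T" free_alg] in blast)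
qed

lemma subst_power: "subst s (p ^ n) = subst s p ^ n"
  using subst_single[of s "[]" 1] by (induction n) (simp_all add: subst_mult)

theorem theorem2p3p2:
  defines "M \<equiv> (sq_central :: ('k::field_char_0, 'k nc_poly set) alg set)"
  shows
    "(\<forall>n\<ge>1. higher_consequences M (cls M (X 1 ^ n)) =
        t_ideal_gen (rel_free M) {cls M (prod_list (map X [1..<n + 2]))})
     \<and> higher_consequences M (cls M (comm (X 1) (X 2) * X 1)) =
        t_ideal_gen (rel_free M) {cls M (X 1 * comm (X 1) (X 2) * X 2)}
     \<and> higher_consequences M (cls M (standard_poly 3)) =
        t_ideal_gen (rel_free M) {cls M (X 1 * comm (X 1) (X 2) * X 2)}
     \<and> higher_consequences M (cls M (X 1 * comm (X 1) (X 2) * X 2)) = {zer (rel_free M)}"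
proof -
  define T where "T = identities_of M"
  interpret T: sq_central_ideal T
    unfolding T_def M_def by (rule sq_central_ideal_identities)
  let ?G = "\<lambda>f. t_ideal_gen free_alg (insert f T)"
  have G: "sq_central_ideal (?G f)" if "f \<in> carr free_alg" for f
    using T.sq_central_ideal_axioms that by (rule sq_central_ideal_gen)
  have self: "f \<in> ?G f" and T_sub: "T \<subseteq> ?G f" for f
    using t_ideal_gen_superset[of "insert f T" free_alg] by blast+
  have T_free: "free_t_ideal (identities_of M)"
    using T.free_t_ideal_axioms by (simp add: T_def)
  let ?g = "X 1 * comm (X 1) (X 2) * X 2 :: 'k nc_poly"
  have g: "?g \<in> carr free_alg" "?g \<in> commutator_ideal" "hom_part 4 ?g = ?g"
    by (simp, intro commutator_ideal_mult comm_in_commutator_ideal, simp,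
      simp add: hom_part_eq comm_def X_def single_mult_single algebra_simps part_minus part_single)
  \<comment> \<open>Modulo the consequences of \<open>?g\<close> commutativity already begins in
    degree 4, just above the degree of the elements in (b).\<close>
  have g_words: "free_t_ideal.words_commute (?G ?g) (Suc 3)"
  proof -
    interpret Gg: sq_central_ideal "?G ?g" by (rule G[OF g(1)])
    have "x * comm x y * y \<in> ?G ?g" if "x \<in> carr free_alg" "y \<in> carr free_alg" for x y
      using Gg.subst[OF self, of "\<lambda>i. if i = 1 then x else y"] that
      by (simp add: subst_mult subst_comm)
    then show ?thesis using Gg.words_commute_4 by simp
  qed
  \<comment> \<open>Both claims of (b) are reduced to showing that \<open>?g\<close> is a
    consequence of \<open>f\<close>.\<close>
  have b: "higher_consequences M (cls M f) = t_ideal_gen (rel_free M) {cls M ?g}"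
    if f: "f \<in> commutator_ideal" "hom_part 3 f = f" "?g \<in> ?G f" for f
  proof (rule higher_consequences_eqI[OF T_free commutator_ideal_carr[OF f(1)] f(2) _ g(3)])
    show "?g \<in> t_ideal_gen free_alg (insert f (identities_of M))"
      using f(3) by (simp add: T_def)
    fix p
    assume "p \<in> t_ideal_gen free_alg (insert f (identities_of M))"
      "part (\<lambda>w. length w \<le> 3) p \<in> identities_of M"
    then show "p \<in> t_ideal_gen free_alg (insert ?g (identities_of M))"
      using high_commutator_in_ideal[OF T_free _ _ g_words f(1)] G[OF g(1)] T_sub
      unfolding sq_central_ideal_def by (simp add: T_def)
  qed simp
  have "higher_consequences M (cls M (X 1 ^ n)) =
      t_ideal_gen (rel_free M) {cls M (prod_list (map X [1..<n + 2]))}" if n: "1 \<le> n" for n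
  proof -
    let ?f = "X 1 ^ n :: 'k nc_poly" and ?w = "single [1..<n + 2] 1 :: 'k nc_poly"
    have f_eq: "?f = single (replicate n 1) 1"
      by (induction n) (simp_all add: X_def single_mult_single)
    have f: "?f \<in> carr free_alg" unfolding f_eq using n by (intro carr_free_algI(9)) auto
    interpret Gf: sq_central_ideal "?G ?f" by (rule G[OF f])
    interpret Gw: sq_central_ideal "?G ?w" by (rule G) simp
    have "x ^ n \<in> ?G ?f" if "x \<in> carr free_alg" for x
      using Gf.subst[OF self, of "\<lambda>_. x"] that by (simp add: subst_power)
    then have "?w \<in> ?G ?f" by (rule Gf.nil_word[OF n])
    moreover have "p \<in> ?G ?w" if "p \<in> ?G ?f" "part (\<lambda>w. length w \<le> n) p \<in> T" for p
      using self Gf.carr[OF that(1)] subsetD[OF T_sub that(2)] by (rule Gw.long_words)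
    moreover have "hom_part n ?f = ?f" "hom_part (n + 1) ?w = ?w"
      unfolding f_eq hom_part_eq part_single by (simp_all del: upt_Suc)
    ultimately have "higher_consequences M (cls M ?f) = t_ideal_gen (rel_free M) {cls M ?w}"
      unfolding T_def by (intro higher_consequences_eqI[OF T_free f]) auto
    then show ?thesis using single_eq_prod[of "[1..<n + 2]" "1 :: 'k"] by simp
  qed
  moreover have "higher_consequences M (cls M (comm (X 1) (X 2) * X 1)) =
      t_ideal_gen (rel_free M) {cls M ?g}"
  proof (rule b)
    let ?f = "comm (X 1) (X 2) * X 1 :: 'k nc_poly"
    show "?f \<in> commutator_ideal" by (intro commutator_ideal_mult comm_in_commutator_ideal) simp
    show "hom_part 3 ?f = ?f"
      by (simp add: hom_part_eq comm_def X_def single_mult_single algebra_simps part_minus part_single)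
    interpret Gf: sq_central_ideal "?G ?f" by (rule G) simp
    have "comm x y * x \<in> ?G ?f" if "x \<in> carr free_alg" "y \<in> carr free_alg" for x y
      using Gf.subst[OF self, of "\<lambda>i. if i = 1 then x else y"] that
      by (simp add: subst_mult subst_comm)
    then show "?g \<in> ?G ?f" by (rule Gf.mult_comm_mult_of_comm_mult) simp_all
  qed
  moreover have "higher_consequences M (cls M (standard_poly 3)) =
      t_ideal_gen (rel_free M) {cls M ?g}"
    unfolding standard_poly_3
  proof (rule b)
    let ?f = "comm (X 1) (X 2) * X 3 + comm (X 2) (X 3) * X 1 + comm (X 3) (X 1) * X 2 :: 'k nc_poly"
    show "?f \<in> commutator_ideal"
      by (intro commutator_ideal_add commutator_ideal_mult comm_in_commutator_ideal) simp_all
    show "hom_part 3 ?f = ?f"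
      by (simp add: hom_part_eq comm_def X_def single_mult_single algebra_simps part_add part_minus part_single)
    interpret Gf: sq_central_ideal "?G ?f" by (rule G) simp
    have "comm x y * z + comm y z * x + comm z x * y \<in> ?G ?f"
      if "x \<in> carr free_alg" "y \<in> carr free_alg" "z \<in> carr free_alg" for x y z
      using Gf.subst[OF self, of "\<lambda>i. if i = 1 then x else if i = 2 then y else z"] that
      by (simp add: subst_add subst_mult subst_comm)
    then show "?g \<in> ?G ?f" by (rule Gf.mult_comm_mult_of_standard3) simp_all
  qed
  moreover have "higher_consequences M (cls M ?g) = {zer (rel_free M)}"
  proof -
    have cls: "cls M = coset free_alg T" by (simp add: cls_def fun_eq_iff T_def)
    \<comment> \<open>The ideal \<open>J\<close> is \<open>T\<close> itself here: above degree 4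
      words commute modulo \<open>T\<close>, so nothing new survives.\<close>
    have "p \<in> T" if "p \<in> ?G ?g" "part (\<lambda>w. length w \<le> 4) p \<in> T" for p
      using T.words_commute_5
      by (intro high_commutator_in_ideal[OF T.free_t_ideal_axioms T.free_t_ideal_axioms _ _ g(2) that]) simp_all
    then have "{p \<in> ?G ?g. part (\<lambda>w. length w \<le> 4) p \<in> T} = T"
      using T_sub T.part_le by blast
    then have "higher_consequences M (cls M ?g) = cls M ` T"
      using higher_consequences_cls[OF T_free g(1,3)] by (simp add: T_def)
    also have "\<dots> = {cls M 0}"
      unfolding cls using T.zero T.coset_eq_iff[of _ 0] by force
    finally show ?thesis by (simp add: rel_free_def T.quot_zer cls flip: T_def)
  qed
  ultimately show ?thesis by blast
qed

end
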